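(* Let $n\ge 2$ and let $H=H(u,x^3,\dots,x^{2n})$ be a smooth function on $\mathbb{R}^{2n}$ with global coordinates $(v,u,x^3,\dots,x^{2n})$, independent of $v$. Let $h=H\,du^2+2\,dv\,du+\sum_{i=3}^{2n}(dx^i)^2$ be the corresponding standard pp-wave metric, and let $g=h+2T^\flat\otimes T^\flat$ be its standard Riemannian dual, where $T=\tfrac12(H+1)\partial_v-\partial_u$ and $T^\flat=h(T,\cdot)$. Set $Z=\tfrac12(H-1)\partial_v-\partial_u$ and $X_i=\partial_{x^i}$ for $i=3,\dots,2n$, and let $J$ be the almost complex structure determined by $$JT=Z,\qquad JX_3=X_4,\ \ JX_5=X_6,\ \dots,\ JX_{2n-1}=X_{2n}$$ (together with $J^2=-1$). Then $(\mathbb{R}^{2n},g,J)$ is a complete almost Kähler manifold with nonpositive scalar curvature. Moreover, it is Kähler (in fact, flat) if and only if $g$ is scalar flat.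
   Context: Here $dv\,du$ denotes the symmetric product, so $h(\partial_v,\partial_u)=1$, $h(\partial_u,\partial_u)=H$, $h(\partial_v,\partial_v)=0$. The metric $h$ is Lorentzian and $h(T,T)=-1$. In the coordinate basis, $g$ has components $g(\partial_v,\partial_v)=2$, $g(\partial_v,\partial_u)=H$, $g(\partial_u,\partial_u)=\tfrac12(1+H^2)$, $g(\partial_{x^i},\partial_{x^j})=\delta_{ij}$, and all others zero; $\{T,X_3,\dots,X_{2n},Z\}$ is a global frame, orthonormal for $g$. An almost complex structure $J$ is a smooth endomorphism of the tangent bundle with $J^2=-1$; it is compatible with $g$ if $g(J\cdot,J\cdot)=g$. A $2n$-dimensional Riemannian manifold $(M,g)$ with compatible almost complex structure $J$ is almost Kähler if the fundamental 2-form $\omega=g(\cdot,J\cdot)$ is closed; it is Kähler if in addition $J$ is integrable, i.e. its Nijenhuis tensor $N_J(a,b)=[Ja,Jb]-J[Ja,b]-J[a,Jb]-[a,b]$ vanishes identically. "Complete" means geodesically complete. "Scalar flat" means the scalar curvature vanishes identically. *)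

theory Defs
  imports "HOL-Analysis.Analysis"
begin

section \<open>Smooth maps on \<open>\<real>\<^sup>d\<close>\<close>

abbreviation coord :: "'d::finite \<Rightarrow> real ^ 'd"
  where "coord i \<equiv> axis i 1"

definition pderiv_at :: "'d::finite \<Rightarrow> (real ^ 'd \<Rightarrow> 'b::real_normed_vector) \<Rightarrow> real ^ 'd \<Rightarrow> 'b"
  where "pderiv_at i f p = frechet_derivative f (at p) (coord i)"

primrec C_k :: "nat \<Rightarrow> (real ^ 'd::finite \<Rightarrow> 'b::real_normed_vector) \<Rightarrow> bool"
  where
    "C_k 0 f \<longleftrightarrow> continuous_on UNIV f"
  | "C_k (Suc k) f \<longleftrightarrow> (\<forall>p. f differentiable (at p)) \<and> (\<forall>i. C_k k (pderiv_at i f))"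

definition smooth :: "(real ^ 'd::finite \<Rightarrow> 'b::real_normed_vector) \<Rightarrow> bool"
  where "smooth f \<longleftrightarrow> (\<forall>k. C_k k f)"


section \<open>Tensor fields on \<open>\<real>\<^sup>d\<close>\<close>

text \<open>All tangent spaces are identified with \<open>real ^ 'd\<close> by the global coordinates;
  the first argument of a tensor field is the base point.\<close>

type_synonym 'd vfield = "real ^ 'd \<Rightarrow> real ^ 'd"
type_synonym 'd endo_field = "real ^ 'd \<Rightarrow> real ^ 'd \<Rightarrow> real ^ 'd"
type_synonym 'd bilin_field = "real ^ 'd \<Rightarrow> real ^ 'd \<Rightarrow> real ^ 'd \<Rightarrow> real"

definition riemannian_metric :: "'d::finite bilin_field \<Rightarrow> bool"
  where "riemannian_metric g \<longleftrightarrow>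
    (\<forall>p. bilinear (g p)) \<and>
    (\<forall>p a b. g p a b = g p b a) \<and>
    (\<forall>p a. a \<noteq> 0 \<longrightarrow> g p a a > 0) \<and>
    (\<forall>i j. smooth (\<lambda>p. g p (coord i) (coord j)))"

definition lie_bracket :: "'d::finite vfield \<Rightarrow> 'd vfield \<Rightarrow> 'd vfield"
  where "lie_bracket X Y p =
    frechet_derivative Y (at p) (X p) - frechet_derivative X (at p) (Y p)"

definition almost_complex :: "'d::finite endo_field \<Rightarrow> bool"
  where "almost_complex J \<longleftrightarrow>
    (\<forall>p. linear (J p)) \<and>
    (\<forall>p a. J p (J p a) = - a) \<and>
    (\<forall>i. smooth (\<lambda>p. J p (coord i)))"

definition compatible :: "'d::finite bilin_field \<Rightarrow> 'd endo_field \<Rightarrow> bool"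
  where "compatible g J \<longleftrightarrow> (\<forall>p a b. g p (J p a) (J p b) = g p a b)"

definition fundamental_form :: "'d::finite bilin_field \<Rightarrow> 'd endo_field \<Rightarrow> 'd bilin_field"
  where "fundamental_form g J p a b = g p a (J p b)"

text \<open>The exterior derivative of a 2-form, evaluated on constant (hence commuting) vector
  fields, so that no bracket terms occur.\<close>

definition ext_deriv :: "'d::finite bilin_field \<Rightarrow> real ^ 'd \<Rightarrow> real ^ 'd \<Rightarrow> real ^ 'd \<Rightarrow> real ^ 'd \<Rightarrow> real"
  where "ext_deriv \<omega> p a b c =
      frechet_derivative (\<lambda>q. \<omega> q b c) (at p) a
    - frechet_derivative (\<lambda>q. \<omega> q a c) (at p) b
    + frechet_derivative (\<lambda>q. \<omega> q a b) (at p) c"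

definition closed_form :: "'d::finite bilin_field \<Rightarrow> bool"
  where "closed_form \<omega> \<longleftrightarrow> (\<forall>p a b c. ext_deriv \<omega> p a b c = 0)"

definition nijenhuis :: "'d::finite endo_field \<Rightarrow> 'd vfield \<Rightarrow> 'd vfield \<Rightarrow> 'd vfield"
  where "nijenhuis J a b p =
      lie_bracket (\<lambda>q. J q (a q)) (\<lambda>q. J q (b q)) p
    - J p (lie_bracket (\<lambda>q. J q (a q)) b p)
    - J p (lie_bracket a (\<lambda>q. J q (b q)) p)
    - lie_bracket a b p"

definition integrable_acs :: "'d::finite endo_field \<Rightarrow> bool"
  where "integrable_acs J \<longleftrightarrow> (\<forall>a b. smooth a \<longrightarrow> smooth b \<longrightarrow> (\<forall>p. nijenhuis J a b p = 0))"

definition almost_kaehler :: "'d::finite bilin_field \<Rightarrow> 'd endo_field \<Rightarrow> bool"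
  where "almost_kaehler g J \<longleftrightarrow>
    riemannian_metric g \<and> almost_complex J \<and> compatible g J \<and> closed_form (fundamental_form g J)"

definition kaehler :: "'d::finite bilin_field \<Rightarrow> 'd endo_field \<Rightarrow> bool"
  where "kaehler g J \<longleftrightarrow> almost_kaehler g J \<and> integrable_acs J"


section \<open>Levi-Civita connection, curvature and geodesics\<close>

definition inv_metric :: "'d::finite bilin_field \<Rightarrow> real ^ 'd \<Rightarrow> real ^ 'd ^ 'd"
  where "inv_metric g p = matrix_inv (\<chi> i j. g p (coord i) (coord j))"

text \<open>\<open>christoffel g k i j\<close> is \<open>\<Gamma>\<^sup>k\<^sub>i\<^sub>j\<close>.\<close>

definition christoffel :: "'d::finite bilin_field \<Rightarrow> 'd \<Rightarrow> 'd \<Rightarrow> 'd \<Rightarrow> real ^ 'd \<Rightarrow> real"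
  where "christoffel g k i j p = (1/2) * (\<Sum>l\<in>UNIV. inv_metric g p $ k $ l *
    (  pderiv_at i (\<lambda>q. g q (coord j) (coord l)) p
     + pderiv_at j (\<lambda>q. g q (coord i) (coord l)) p
     - pderiv_at l (\<lambda>q. g q (coord i) (coord j)) p))"

text \<open>\<open>riemann g l k i j\<close> is the \<open>\<partial>\<^sub>l\<close>-component of \<open>R(\<partial>\<^sub>i, \<partial>\<^sub>j) \<partial>\<^sub>k\<close>, where
  \<open>R(X, Y) = [\<nabla>\<^sub>X, \<nabla>\<^sub>Y] - \<nabla>\<^bsub>[X, Y]\<^esub>\<close>.  The Ricci tensor is the trace over \<open>X\<close>, so that round
  spheres have positive scalar curvature.\<close>

definition riemann :: "'d::finite bilin_field \<Rightarrow> 'd \<Rightarrow> 'd \<Rightarrow> 'd \<Rightarrow> 'd \<Rightarrow> real ^ 'd \<Rightarrow> real"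
  where "riemann g l k i j p =
      pderiv_at i (christoffel g l j k) p - pderiv_at j (christoffel g l i k) p
    + (\<Sum>m\<in>UNIV. christoffel g l i m p * christoffel g m j k p
              - christoffel g l j m p * christoffel g m i k p)"

definition ricci :: "'d::finite bilin_field \<Rightarrow> 'd \<Rightarrow> 'd \<Rightarrow> real ^ 'd \<Rightarrow> real"
  where "ricci g j k p = (\<Sum>i\<in>UNIV. riemann g i k i j p)"

definition scalar_curvature :: "'d::finite bilin_field \<Rightarrow> real ^ 'd \<Rightarrow> real"
  where "scalar_curvature g p = (\<Sum>j\<in>UNIV. \<Sum>k\<in>UNIV. inv_metric g p $ j $ k * ricci g j k p)"

definition scalar_flat :: "'d::finite bilin_field \<Rightarrow> bool"
  where "scalar_flat g \<longleftrightarrow> (\<forall>p. scalar_curvature g p = 0)"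

definition flat_metric :: "'d::finite bilin_field \<Rightarrow> bool"
  where "flat_metric g \<longleftrightarrow> (\<forall>l k i j p. riemann g l k i j p = 0)"

definition geodesic_on :: "'d::finite bilin_field \<Rightarrow> real set \<Rightarrow> (real \<Rightarrow> real ^ 'd) \<Rightarrow> bool"
  where "geodesic_on g I \<gamma> \<longleftrightarrow> (\<exists>\<gamma>'. \<forall>t\<in>I.
    (\<gamma> has_vector_derivative \<gamma>' t) (at t) \<and>
    (\<gamma>' has_vector_derivative
      (\<chi> k. - (\<Sum>i\<in>UNIV. \<Sum>j\<in>UNIV. christoffel g k i j (\<gamma> t) * \<gamma>' t $ i * \<gamma>' t $ j))) (at t))"

text \<open>Every geodesic defined on an open interval extends to all of \<open>\<real>\<close>, i.e. every maximal
  geodesic is defined for all times.\<close>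

definition geodesically_complete :: "'d::finite bilin_field \<Rightarrow> bool"
  where "geodesically_complete g \<longleftrightarrow>
    (\<forall>I \<gamma>. open I \<and> is_interval I \<and> I \<noteq> {} \<and> geodesic_on g I \<gamma> \<longrightarrow>
      (\<exists>\<eta>. geodesic_on g UNIV \<eta> \<and> (\<forall>t\<in>I. \<eta> t = \<gamma> t)))"


section \<open>Standard pp-waves and their Riemannian duals\<close>

text \<open>The coordinates \<open>(v, u, x\<^sup>3, \<dots>, x\<^sup>2\<^sup>n)\<close> on \<open>real ^ 'd\<close> with \<open>CARD('d) = 2 * n\<close> are labelled by a
  bijection \<open>c\<close> from \<open>{1..2*n}\<close> onto the index type: \<open>p $ c 1\<close> is \<open>v\<close>, \<open>p $ c 2\<close> is \<open>u\<close>, and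
  \<open>p $ c i\<close> is \<open>x\<^sup>i\<close> for \<open>i \<in> {3..2*n}\<close>.\<close>

definition pp_wave :: "nat \<Rightarrow> (nat \<Rightarrow> 'd::finite) \<Rightarrow> (real ^ 'd \<Rightarrow> real) \<Rightarrow> 'd bilin_field"
  where "pp_wave n c H p a b =
      H p * a $ c 2 * b $ c 2 + (a $ c 1 * b $ c 2 + a $ c 2 * b $ c 1)
    + (\<Sum>i\<in>{3..2*n}. a $ c i * b $ c i)"

definition T_field :: "(nat \<Rightarrow> 'd::finite) \<Rightarrow> (real ^ 'd \<Rightarrow> real) \<Rightarrow> 'd vfield"
  where "T_field c H p = ((H p + 1) / 2) *\<^sub>R coord (c 1) - coord (c 2)"

definition Z_field :: "(nat \<Rightarrow> 'd::finite) \<Rightarrow> (real ^ 'd \<Rightarrow> real) \<Rightarrow> 'd vfield"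
  where "Z_field c H p = ((H p - 1) / 2) *\<^sub>R coord (c 1) - coord (c 2)"

definition pp_dual :: "nat \<Rightarrow> (nat \<Rightarrow> 'd::finite) \<Rightarrow> (real ^ 'd \<Rightarrow> real) \<Rightarrow> 'd bilin_field"
  where "pp_dual n c H p a b =
    pp_wave n c H p a b
    + 2 * (pp_wave n c H p (T_field c H p) a * pp_wave n c H p (T_field c H p) b)"

definition pp_J :: "nat \<Rightarrow> (nat \<Rightarrow> 'd::finite) \<Rightarrow> (real ^ 'd \<Rightarrow> real) \<Rightarrow> 'd endo_field"
  where "pp_J n c H p = (THE L. linear L \<and> (\<forall>a. L (L a) = - a) \<and>
    L (T_field c H p) = Z_field c H p \<and>
    (\<forall>k\<in>{2..n}. L (coord (c (2*k - 1))) = coord (c (2*k))))"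

end

theory Submission
  imports Defs
begin

text \<open>In coordinates \<open>g = (2 dv + H du)\<^sup>2 / 2 + du\<^sup>2 / 2 + \<Sum> (dx\<^sup>i)\<^sup>2\<close>, and \<open>J\<close> acts on the
  \<open>(v, u)\<close>-plane by a matrix of determinant one that makes \<open>\<omega>\<close> the constant form
  \<open>dv \<and> du - \<Sum> dx\<^bsup>2k-1\<^esup> \<and> dx\<^bsup>2k\<^esup>\<close>, which is closed.  The scalar curvature is
  \<open>- (\<Sum> (\<partial>\<^sub>i H)\<^sup>2) / 2\<close>, summed over the transverse coordinates \<open>x\<^sup>i\<close>, so scalar flatness means
  \<open>H = H(u)\<close>; then the only Christoffel symbol is \<open>\<Gamma>\<^sup>v\<^sub>u\<^sub>u = H'(u) / 2\<close> and \<open>g\<close> is flat.  The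
  \<open>\<partial>\<^sub>u\<close>-component of \<open>N\<^sub>J(\<partial>\<^sub>v, X\<^sub>i)\<close> is \<open>- 2 \<partial>\<^sub>i H\<close>, so integrability of \<open>J\<close> forces the same
  condition.  For completeness, the Killing field \<open>\<partial>\<^sub>v\<close> gives the conserved momentum
  \<open>c = 2 v' + H u'\<close> of a geodesic, and the remaining coordinates move like a charged particle in a
  magnetic field on flat space: the force is skew and linear in the velocity, so the speed is
  constant and solutions cannot escape in finite time.\<close>

section \<open>Global solutions of ordinary differential equations\<close>

text \<open>The oriented integral from 0 to \<open>t\<close>: for either sign of \<open>t\<close>
  one of the two integrals is over an empty or trivial interval and vanishes.\<close>

definition primitive :: "(real \<Rightarrow> 'a::banach) \<Rightarrow> real \<Rightarrow> 'a"
  where "primitive f t = integral {0..t} f - integral {t..0} f"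

lemma primitive_0 [simp]: "primitive f 0 = 0"
  by (simp add: primitive_def)

text \<open>From a base point \<open>a\<close> to the left of both 0 and \<open>t\<close>, the
  oriented integral differs from an ordinary one by a constant. This reduces its derivative to the
  fundamental theorem of calculus on an interval around \<open>t\<close>.\<close>

lemma primitive_eq_integral_diff:
  fixes f :: "real \<Rightarrow> 'a::banach"
  assumes "continuous_on UNIV f" and "a \<le> 0" and "a \<le> t"
  shows "primitive f t = integral {a..t} f - integral {a..0} f"
proof -
  have int: "f integrable_on {x..y}" for x y
    using assms(1) continuous_on_subset integrable_continuous_real by blast
  show ?thesis
  proof (cases "0 \<le> t")
    case True
    then have "integral {t..0} f = 0"
      by (cases "t = 0") auto
    then show ?thesis
      using Henstock_Kurzweil_Integration.integral_combine[OF assms(2) True int] by (simp add: primitive_def algebra_simps)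
  next
    case False
    then show ?thesis
      using Henstock_Kurzweil_Integration.integral_combine[OF assms(3) _ int, of 0] by (simp add: primitive_def algebra_simps)
  qed
qed

lemma primitive_has_vector_derivative:
  fixes f :: "real \<Rightarrow> 'a::banach"
  assumes "continuous_on UNIV f"
  shows "(primitive f has_vector_derivative f t) (at t)"
proof -
  define a where "a = - \<bar>t\<bar> - 1"
  have "continuous_on {a..\<bar>t\<bar> + 1} f"
    using assms continuous_on_subset by blast
  then have "((\<lambda>x. integral {a..x} f) has_vector_derivative f t) (at t within {a..\<bar>t\<bar> + 1})"
    by (rule integral_has_vector_derivative) (auto simp: a_def)
  moreover have "at t within {a..\<bar>t\<bar> + 1} = at t"
    by (rule at_within_interior) (auto simp: a_def)
  ultimately have "((\<lambda>x. integral {a..x} f) has_vector_derivative f t) (at t)"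
    by simp
  then have "((\<lambda>x. integral {a..x} f - integral {a..0} f) has_vector_derivative f t) (at t)"
    by (auto intro!: derivative_eq_intros)
  then show ?thesis
  proof (rule has_vector_derivative_transform_within_open[where S = "{a<..}"])
    show "t \<in> {a<..}" by (auto simp: a_def)
  qed (use primitive_eq_integral_diff[OF assms, of a] in \<open>auto simp: a_def\<close>)
qed

text \<open>Integration gains the factor \<open>1 / K\<close>, which is what makes the Picard
  operator contract in an exponentially weighted norm. The mean value inequality is applied
  separately for the two signs of \<open>t\<close>, because the absolute value has a corner at
  0.\<close>

lemma norm_le_exp_growth:
  fixes D :: "real \<Rightarrow> 'a::real_normed_vector"
  assumes D: "\<And>t. (D has_vector_derivative d t) (at t)" and "D 0 = 0"
    and d: "\<And>t. norm (d t) \<le> M * exp (K * \<bar>t\<bar>)" and "K > 0"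
  shows "norm (D t) \<le> M / K * exp (K * \<bar>t\<bar>)"
proof -
  have "M \<ge> 0"
    using order_trans[OF norm_ge_zero d[of 0]] by simp
  have cont: "continuous_on S D" for S
    by (meson D continuous_at_imp_continuous_on has_vector_derivative_continuous)
  consider "t = 0" | "t > 0" | "t < 0" by linarith
  then show ?thesis
  proof cases
    case 1
    then show ?thesis using assms(2,4) \<open>M \<ge> 0\<close> by simp
  next
    case 2
    have "norm (D t - D 0) \<le> M / K * exp (K * t) - M / K * exp (K * 0)"
      using 2
    proof (rule differentiable_bound_general[where f' = d and \<phi>' = "\<lambda>s. M * exp (K * s)"])
      show "((\<lambda>s. M / K * exp (K * s)) has_vector_derivative M * exp (K * x)) (at x)" for x
        using \<open>K > 0\<close> by (auto intro!: derivative_eq_intros simp flip: has_real_derivative_iff_has_vector_derivative)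
      show "norm (d s) \<le> M * exp (K * s)" if "0 < s" for s
        using d[of s] that by simp
    qed (use \<open>K > 0\<close> in \<open>auto intro!: continuous_intros D cont\<close>)
    also have "\<dots> \<le> M / K * exp (K * t)"
      using \<open>K > 0\<close> \<open>M \<ge> 0\<close> by simp
    finally show ?thesis using 2 assms(2) by simp
  next
    case 3
    have "norm (D 0 - D t) \<le> - (M / K * exp (- K * 0)) - - (M / K * exp (- K * t))"
      using 3
    proof (rule differentiable_bound_general[where f' = d and \<phi>' = "\<lambda>s. M * exp (- K * s)"])
      show "((\<lambda>s. - (M / K * exp (- K * s))) has_vector_derivative M * exp (- K * x)) (at x)" for x
        using \<open>K > 0\<close> by (auto intro!: derivative_eq_intros simp flip: has_real_derivative_iff_has_vector_derivative)
      show "norm (d s) \<le> M * exp (- K * s)" if "s < 0" for s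
        using d[of s] that by simp
    qed (use \<open>K > 0\<close> in \<open>auto intro!: continuous_intros D cont\<close>)
    also have "\<dots> \<le> M / K * exp (- K * t)"
      using \<open>K > 0\<close> \<open>M \<ge> 0\<close> by simp
    finally show ?thesis using 3 assms(2) by simp
  qed
qed

text \<open>Picard iteration on the whole line at once. Writing \<open>y - y0\<close> as
  \<open>exp (K * \<bar>t\<bar>)\<close> times a bounded continuous function (Bielecki's weight)
  turns the integral operator into a contraction of a Banach space, so no local solutions have to be
  glued.\<close>

lemma lipschitz_ode_global_solution:
  fixes F :: "'a::banach \<Rightarrow> 'a"
  assumes L: "L-lipschitz_on UNIV F"
  obtains y where "y 0 = y0" and "\<And>t. (y has_vector_derivative F (y t)) (at t)"
proof -
  \<comment> \<open>The contraction factor will be \<open>L / K\<close>; the factor 2 makes it at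
    most one half, and the summand 1 keeps \<open>K\<close> positive when
    \<open>L = 0\<close>.\<close>
  define K where "K = 2 * L + 1"
  have "L \<ge> 0" using L lipschitz_on_nonneg by blast
  then have "K > 0" "L / K \<le> 1 / 2" by (auto simp: K_def field_simps)
  have contF: "continuous_on S F" for S
    using L lipschitz_on_continuous_on continuous_on_subset subset_UNIV by metis
  have normF: "norm (F a - F b) \<le> L * norm (a - b)" for a b
    using lipschitz_on_normD[OF L] by simp
  define f where "f z s = F (y0 + exp (K * \<bar>s\<bar>) *\<^sub>R apply_bcontfun z s)" for z :: "real \<Rightarrow>\<^sub>C 'a" and s
  \<comment> \<open>The Picard operator conjugated by the weight: a fixed point \<open>z\<close>
    corresponds to the solution \<open>y0 + exp (K * \<bar>t\<bar>) *\<^sub>R z t\<close>.\<close>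
  define \<Psi> where "\<Psi> z t = exp (- K * \<bar>t\<bar>) *\<^sub>R primitive (f z) t" for z t
  have cf: "continuous_on UNIV (f z)" for z
    unfolding f_def by (rule continuous_on_compose2[OF contF[of UNIV]]) (auto intro!: continuous_intros)
  note D = primitive_has_vector_derivative[OF cf]
  have cp: "continuous_on UNIV (primitive (f z))" for z
    by (meson D continuous_at_imp_continuous_on has_vector_derivative_continuous)
  have "\<Psi> z \<in> bcontfun" for z
  proof (rule bcontfun_normI)
    show "continuous_on UNIV (\<Psi> z)"
      unfolding \<Psi>_def by (intro continuous_intros cp)
    define M where "M = norm (F y0) + L * norm z"
    have "norm (f z s) \<le> M * exp (K * \<bar>s\<bar>)" for s
    proof -
      have "norm (f z s - F y0) \<le> L * (exp (K * \<bar>s\<bar>) * norm (apply_bcontfun z s))"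
        using normF[of "y0 + exp (K * \<bar>s\<bar>) *\<^sub>R apply_bcontfun z s" y0] by (simp add: f_def)
      also have "\<dots> \<le> L * (exp (K * \<bar>s\<bar>) * norm z)"
        using \<open>L \<ge> 0\<close> by (intro mult_left_mono norm_bounded) auto
      finally have "norm (f z s) \<le> norm (F y0) + L * norm z * exp (K * \<bar>s\<bar>)"
        using norm_triangle_sub[of "f z s" "F y0"] by (simp add: mult.assoc mult.commute)
      also have "norm (F y0) * 1 \<le> norm (F y0) * exp (K * \<bar>s\<bar>)"
        using \<open>K > 0\<close> by (intro mult_left_mono) auto
      then have "norm (F y0) + L * norm z * exp (K * \<bar>s\<bar>) \<le> M * exp (K * \<bar>s\<bar>)"
        by (simp add: M_def algebra_simps)
      finally show ?thesis .
    qed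
    then have "norm (primitive (f z) t) \<le> M / K * exp (K * \<bar>t\<bar>)" for t
      by (intro norm_le_exp_growth[OF D]) (auto simp: \<open>K > 0\<close>)
    then show "norm (\<Psi> z t) \<le> M / K" for t
      by (simp add: \<Psi>_def exp_minus field_simps)
  qed
  then have app: "apply_bcontfun (Bcontfun (\<Psi> z)) = \<Psi> z" for z
    by (simp add: Bcontfun_inverse)
  have "\<exists>!z. Bcontfun (\<Psi> z) = z"
  proof (rule banach_fix_type[of "1 / 2"])
    show "\<forall>z w. dist (Bcontfun (\<Psi> z)) (Bcontfun (\<Psi> w)) \<le> 1 / 2 * dist z w"
    proof (intro allI dist_bound)
      fix z w t
      have "norm (f z s - f w s) \<le> L * dist z w * exp (K * \<bar>s\<bar>)" for s
      proof -
        have "norm (f z s - f w s) \<le> L * (exp (K * \<bar>s\<bar>) * norm (apply_bcontfun z s - apply_bcontfun w s))"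
          using normF[of "y0 + exp (K * \<bar>s\<bar>) *\<^sub>R apply_bcontfun z s" "y0 + exp (K * \<bar>s\<bar>) *\<^sub>R apply_bcontfun w s"]
          by (simp add: f_def flip: scaleR_diff_right)
        also have "\<dots> \<le> L * (exp (K * \<bar>s\<bar>) * dist z w)"
          using \<open>L \<ge> 0\<close> dist_bounded[of z s w] by (intro mult_left_mono) (auto simp: dist_norm)
        finally show ?thesis by (simp add: mult_ac)
      qed
      then have "norm (primitive (f z) t - primitive (f w) t) \<le> L * dist z w / K * exp (K * \<bar>t\<bar>)"
        by (intro norm_le_exp_growth[where d = "\<lambda>s. f z s - f w s"] has_vector_derivative_diff D)
           (auto simp: \<open>K > 0\<close>)
      then have "exp (- K * \<bar>t\<bar>) * norm (primitive (f z) t - primitive (f w) t)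
          \<le> exp (- K * \<bar>t\<bar>) * (L * dist z w / K * exp (K * \<bar>t\<bar>))"
        by (intro mult_left_mono) auto
      also have "\<dots> = L / K * dist z w"
        by (simp add: exp_minus)
      also have "exp (- K * \<bar>t\<bar>) * norm (primitive (f z) t - primitive (f w) t) = dist (\<Psi> z t) (\<Psi> w t)"
        by (simp add: \<Psi>_def dist_norm flip: scaleR_diff_right)
      finally have "dist (\<Psi> z t) (\<Psi> w t) \<le> L / K * dist z w" .
      also have "\<dots> \<le> 1 / 2 * dist z w"
        using \<open>L / K \<le> 1 / 2\<close> by (intro mult_right_mono) auto
      finally show "dist (apply_bcontfun (Bcontfun (\<Psi> z)) t) (apply_bcontfun (Bcontfun (\<Psi> w)) t) \<le> 1 / 2 * dist z w"
        by (simp add: app)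
    qed
  qed auto
  then obtain z where "Bcontfun (\<Psi> z) = z" by blast
  then have "apply_bcontfun z = \<Psi> z" by (metis app)
  \<comment> \<open>At the fixed point the weights cancel, which leaves the integral equation for
    \<open>y0 + primitive (f z)\<close>.\<close>
  then have "f z = (\<lambda>s. F (y0 + primitive (f z) s))"
    by (intro ext, subst f_def) (simp add: \<Psi>_def exp_minus)
  then have "((\<lambda>s. y0 + primitive (f z) s) has_vector_derivative F (y0 + primitive (f z) t)) (at t)" for t
    using D[of z t] by (auto intro!: derivative_eq_intros dest: fun_cong)
  then show thesis
    by (intro that[of "\<lambda>s. y0 + primitive (f z) s"]) auto
qed

text \<open>Multiplied by the decaying exponential, \<open>\<phi>\<close> is nonincreasing to the
  right of \<open>a\<close>; multiplied by the growing one, it is nondecreasing to the left. The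
  bound on the absolute value of the derivative serves both directions of time.\<close>

lemma gronwall_zero:
  fixes \<phi> :: "real \<Rightarrow> real"
  assumes der: "\<And>s. s \<in> closed_segment a t \<Longrightarrow> (\<phi> has_real_derivative \<phi>' s) (at s)"
    and bnd: "\<And>s. s \<in> closed_segment a t \<Longrightarrow> \<bar>\<phi>' s\<bar> \<le> L * \<phi> s"
    and "\<phi> a = 0" and "\<phi> t \<ge> 0"
  shows "\<phi> t = 0"
proof (cases "a \<le> t")
  case True
  have "\<phi> t * exp (- L * t) \<le> \<phi> a * exp (- L * a)"
  proof (rule DERIV_nonpos_imp_nonincreasing[OF True, where f = "\<lambda>s. \<phi> s * exp (- L * s)"])
    fix s assume s: "a \<le> s" "s \<le> t"
    then have "((\<lambda>s. \<phi> s * exp (- L * s)) has_real_derivative (\<phi>' s - L * \<phi> s) * exp (- L * s)) (at s)"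
      using der[of s] by (auto intro!: derivative_eq_intros simp: closed_segment_eq_real_ivl algebra_simps)
    moreover have "(\<phi>' s - L * \<phi> s) * exp (- L * s) \<le> 0"
      using bnd[of s] s by (auto simp: closed_segment_eq_real_ivl mult_le_0_iff)
    ultimately show "\<exists>y. ((\<lambda>s. \<phi> s * exp (- L * s)) has_real_derivative y) (at s) \<and> y \<le> 0"
      by blast
  qed
  then show ?thesis using assms(3,4) by (simp add: mult_le_0_iff)
next
  case False
  have "\<phi> t * exp (L * t) \<le> \<phi> a * exp (L * a)"
  proof (rule DERIV_nonneg_imp_nondecreasing[where f = "\<lambda>s. \<phi> s * exp (L * s)"])
    fix s assume s: "t \<le> s" "s \<le> a"
    then have "((\<lambda>s. \<phi> s * exp (L * s)) has_real_derivative (\<phi>' s + L * \<phi> s) * exp (L * s)) (at s)"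
      using der[of s] by (auto intro!: derivative_eq_intros simp: closed_segment_eq_real_ivl algebra_simps)
    moreover have "(\<phi>' s + L * \<phi> s) * exp (L * s) \<ge> 0"
      using bnd[of s] s False by (auto simp: closed_segment_eq_real_ivl)
    ultimately show "\<exists>y. ((\<lambda>s. \<phi> s * exp (L * s)) has_real_derivative y) (at s) \<and> y \<ge> 0"
      by blast
  qed (use False in auto)
  then show ?thesis using assms(3,4) by (simp add: mult_le_0_iff)
qed

text \<open>Gronwall for the squared distance of the two solutions. Over a compact segment both stay
  in one ball, on which a single Lipschitz constant is available.\<close>

lemma ode_unique:
  fixes F :: "'a::real_inner \<Rightarrow> 'a"
  assumes lip: "\<And>R. \<exists>L. L-lipschitz_on (cball 0 R) F"
    and I: "is_interval I" and ab: "a \<in> I" "t \<in> I"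
    and x: "\<And>s. s \<in> I \<Longrightarrow> (x has_vector_derivative F (x s)) (at s)"
    and y: "\<And>s. s \<in> I \<Longrightarrow> (y has_vector_derivative F (y s)) (at s)"
    and "x a = y a"
  shows "x t = y t"
proof -
  let ?S = "closed_segment a t"
  have S: "?S \<subseteq> I"
    using I ab by (meson closed_segment_subset is_interval_convex)
  have "continuous_on ?S x" "continuous_on ?S y"
    using S x y by (auto intro!: continuous_at_imp_continuous_on dest: has_vector_derivative_continuous)
  then have "bounded (x ` ?S \<union> y ` ?S)"
    by (intro compact_imp_bounded compact_Un compact_continuous_image) auto
  then obtain R where R: "\<And>z. z \<in> x ` ?S \<union> y ` ?S \<Longrightarrow> norm z \<le> R"
    by (meson bounded_iff)
  obtain L where L: "L-lipschitz_on (cball 0 R) F" using lip by blast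
  define \<phi> where "\<phi> s = (x s - y s) \<bullet> (x s - y s)" for s
  have "\<phi> t = 0"
  proof (rule gronwall_zero[where \<phi> = \<phi> and a = a and L = "2 * L"])
    fix s assume s: "s \<in> ?S"
    have "((\<lambda>s. x s - y s) has_vector_derivative F (x s) - F (y s)) (at s)"
      using s S by (intro has_vector_derivative_diff x y) auto
    from bounded_bilinear.has_vector_derivative[OF bounded_bilinear_inner this this]
    show "(\<phi> has_real_derivative 2 * ((x s - y s) \<bullet> (F (x s) - F (y s)))) (at s)"
      by (simp add: \<phi>_def[abs_def] has_real_derivative_iff_has_vector_derivative inner_commute)
    have "\<bar>(x s - y s) \<bullet> (F (x s) - F (y s))\<bar> \<le> norm (x s - y s) * norm (F (x s) - F (y s))"
      by (rule Cauchy_Schwarz_ineq2)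
    also have "norm (F (x s) - F (y s)) \<le> L * norm (x s - y s)"
      using lipschitz_on_normD[OF L] R s by auto
    finally have "\<bar>(x s - y s) \<bullet> (F (x s) - F (y s))\<bar> \<le> L * \<phi> s"
      by (simp add: \<phi>_def dot_square_norm power2_eq_square mult_right_mono mult_ac)
    then show "\<bar>2 * ((x s - y s) \<bullet> (F (x s) - F (y s)))\<bar> \<le> 2 * L * \<phi> s"
      by (simp add: abs_mult)
  qed (auto simp: \<phi>_def \<open>x a = y a\<close>)
  then show ?thesis by (simp add: \<phi>_def)
qed


text \<open>Solutions on the intervals of radius \<open>k\<close> agree on overlaps by uniqueness,
  so they paste together to one on the whole line.\<close>

lemma ode_global_from_bounded_intervals:
  fixes F :: "'a::real_inner \<Rightarrow> 'a"
  assumes lip: "\<And>R. \<exists>L. L-lipschitz_on (cball 0 R) F"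
    and ex: "\<And>k::nat. \<exists>y. y 0 = y0 \<and> (\<forall>t. \<bar>t\<bar> < real k \<longrightarrow> (y has_vector_derivative F (y t)) (at t))"
  obtains y where "y 0 = y0" and "\<And>t. (y has_vector_derivative F (y t)) (at t)"
proof -
  from ex obtain Y where Y0: "\<And>k. Y k 0 = y0"
    and Y: "\<And>k t. \<bar>t\<bar> < real k \<Longrightarrow> (Y k has_vector_derivative F (Y k t)) (at t)"
    by metis
  have agree: "Y j t = Y k t" if "\<bar>t\<bar> < real j" "\<bar>t\<bar> < real k" for j k t
  proof (rule ode_unique[OF lip, where a = 0 and I = "{- min (real j) (real k)<..<min (real j) (real k)}"])
    show "Y j 0 = Y k 0" by (simp add: Y0)
  qed (use that in \<open>auto intro!: Y simp: is_interval_convex_1\<close>)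
  \<comment> \<open>The successor makes the inequality strict, so that \<open>t\<close> is an
    interior point of the interval on which \<open>Y (\<kappa> t)\<close> solves the
    equation.\<close>
  define \<kappa> where "\<kappa> t = Suc (nat \<lceil>\<bar>t\<bar>\<rceil>)" for t :: real
  have \<kappa>: "\<bar>t\<bar> < real (\<kappa> t)" for t
    unfolding \<kappa>_def by linarith
  show thesis
  proof
    show "Y (\<kappa> 0) 0 = y0" by (rule Y0)
    show "((\<lambda>t. Y (\<kappa> t) t) has_vector_derivative F (Y (\<kappa> t) t)) (at t)" for t
    proof (rule has_vector_derivative_transform_within_open[OF Y[OF \<kappa>]])
      show "t \<in> {- real (\<kappa> t)<..<real (\<kappa> t)}" using \<kappa>[of t] by auto
      show "Y (\<kappa> t) s = Y (\<kappa> s) s" if "s \<in> {- real (\<kappa> t)<..<real (\<kappa> t)}" for s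
        using that \<kappa>[of s] by (intro agree) auto
    qed auto
  qed
qed

text \<open>Only radiality matters later: a force that is homogeneous in the velocity and skew stays
  skew when the velocity is projected. Outside the ball, the reverse triangle inequality shows that
  the rescaled vector is the nearest point.\<close>

lemma closest_point_cball_0:
  fixes w :: "'a::euclidean_space"
  assumes "R \<ge> 0"
  obtains s where "closest_point (cball 0 R) w = s *\<^sub>R w"
proof (cases "norm w \<le> R")
  case True
  then show thesis by (intro that[of 1]) (simp add: closest_point_self)
next
  case False
  have "(R / norm w) *\<^sub>R w = closest_point (cball 0 R) w"
  proof (rule closest_point_unique)
    have "dist w ((R / norm w) *\<^sub>R w) = norm ((1 - R / norm w) *\<^sub>R w)"
      by (simp add: dist_norm scaleR_diff_left)
    also have "\<dots> = (1 - R / norm w) * norm w"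
      using False assms by (subst norm_scaleR, subst abs_of_nonneg) (auto simp: divide_le_eq_1)
    also have "\<dots> = norm w - R"
      using False assms by (cases "w = 0") (auto simp: left_diff_distrib)
    finally have "dist w ((R / norm w) *\<^sub>R w) = norm w - R" .
    moreover have "norm w - R \<le> dist w z" if "z \<in> cball 0 R" for z
      using norm_triangle_ineq2[of w z] that by (auto simp: dist_norm)
    ultimately show "\<forall>z\<in>cball 0 R. dist w ((R / norm w) *\<^sub>R w) \<le> dist w z"
      by auto
  qed (use False assms in auto)
  then show thesis by (metis that)
qed

section \<open>Second-order equations with a skew force\<close>

lemma second_order_field_lipschitz:
  fixes A :: "'a::real_inner \<Rightarrow> 'a \<Rightarrow> 'a"
  assumes "\<And>R. \<exists>L. L-lipschitz_on (cball 0 R \<times> cball 0 R) (\<lambda>(q, w). A q w)"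
  shows "\<exists>L. L-lipschitz_on (cball 0 R) (\<lambda>(q, w). (w, A q w))"
proof -
  have "1-lipschitz_on S (snd :: 'a \<times> 'a \<Rightarrow> 'a)" for S
    by (rule lipschitz_onI) (simp_all add: dist_snd_le)
  moreover obtain L where "L-lipschitz_on (cball 0 R \<times> cball 0 R) (\<lambda>(q, w). A q w)"
    using assms by blast
  ultimately have "\<exists>L. L-lipschitz_on (cball 0 R \<times> cball 0 R) (\<lambda>(q, w). (w, A q w))"
    using lipschitz_on_Pair by (fastforce simp: case_prod_unfold)
  moreover have "cball 0 R \<subseteq> (cball 0 R \<times> cball 0 R :: ('a \<times> 'a) set)"
    by (auto intro: order_trans[OF norm_fst_le] order_trans[OF norm_snd_le])
  ultimately show ?thesis
    using lipschitz_on_subset by blast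
qed

text \<open>The energy \<open>N w w\<close> is conserved because \<open>A q\<close> is \<open>N\<close>-skew.  Replacing \<open>q\<close> and \<open>w\<close> by
  their projections to large balls makes the field globally Lipschitz, and as the projection of \<open>w\<close>
  is radial the energy is still conserved; hence the cut-off never acts on the velocity.\<close>

lemma skew_second_order_global_solution:
  fixes A :: "'a::euclidean_space \<Rightarrow> 'a \<Rightarrow> 'a"
  assumes lip: "\<And>R. \<exists>L. L-lipschitz_on (cball 0 R \<times> cball 0 R) (\<lambda>(q, w). A q w)"
    and hom: "\<And>q w s. A q (s *\<^sub>R w) = s *\<^sub>R A q w"
    and N: "bounded_bilinear N" "\<And>a b. N a b = N b a" "m > 0" "\<And>w. m * (norm w)\<^sup>2 \<le> N w w"
    and skew: "\<And>q w. N w (A q w) = (0::real)"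
  obtains y where "y 0 = (q0, w0)"
    and "\<And>t. (y has_vector_derivative (case y t of (q, w) \<Rightarrow> (w, A q w))) (at t)"
proof (rule ode_global_from_bounded_intervals[of "\<lambda>(q, w). (w, A q w)" "(q0, w0)"])
  interpret N: bounded_bilinear N by (rule N(1))
  have fst: "1-lipschitz_on S (fst :: 'a \<times> 'a \<Rightarrow> 'a)" and snd: "1-lipschitz_on S (snd :: 'a \<times> 'a \<Rightarrow> 'a)" for S
    by (rule lipschitz_onI; simp add: dist_fst_le dist_snd_le)+
  show "\<exists>L. L-lipschitz_on (cball 0 R) (\<lambda>(q, w). (w, A q w))" for R
    using lip by (rule second_order_field_lipschitz)
  fix k :: nat
  \<comment> \<open>The bound on the speed that conservation of \<open>N w w\<close> gives together
    with \<open>m * (norm w)\<^sup>2 \<le> N w w\<close>.\<close>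
  define E where "E = sqrt (N w0 w0 / m)"
  \<comment> \<open>At speed at most \<open>E\<close> the position stays within
    \<open>norm q0 + E * real k\<close> up to time \<open>k\<close>; the last summand makes room for
    the velocity as well. Hence neither projection acts on this time interval.\<close>
  define R where "R = norm q0 + E * real k + E"
  have N0: "N w w \<ge> 0" for w
    by (rule order_trans[OF _ N(4)]) (use N(3) in auto)
  then have "E \<ge> 0" using N(3) by (simp add: E_def)
  then have "R \<ge> E" "R \<ge> 0" by (auto simp: R_def)
  let ?\<pi> = "closest_point (cball 0 R) :: 'a \<Rightarrow> 'a"
  obtain L where L: "L-lipschitz_on (cball 0 R \<times> cball 0 R) (\<lambda>(q, w). A q w)"
    using lip by blast
  define F where "F = (\<lambda>(q, w). (w, A (?\<pi> q) (?\<pi> w)))"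
  have in\<pi>: "?\<pi> x \<in> cball 0 R" for x
    using \<open>R \<ge> 0\<close> by (intro closest_point_in_set) auto
  have "(L * sqrt (1\<^sup>2 + 1\<^sup>2))-lipschitz_on UNIV (\<lambda>z. A (?\<pi> (fst z)) (?\<pi> (snd z)))"
  proof -
    have \<pi>: "1-lipschitz_on UNIV ?\<pi>"
      using \<open>R \<ge> 0\<close> by (intro lipschitz_onI) (auto intro!: closest_point_lipschitz)
    have "(1 * 1)-lipschitz_on UNIV (\<lambda>z::'a \<times> 'a. ?\<pi> (fst z))"
      by (rule lipschitz_on_compose2[OF fst lipschitz_on_subset[OF \<pi>]]) auto
    moreover have "(1 * 1)-lipschitz_on UNIV (\<lambda>z::'a \<times> 'a. ?\<pi> (snd z))"
      by (rule lipschitz_on_compose2[OF snd lipschitz_on_subset[OF \<pi>]]) auto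
    ultimately have "(sqrt (1\<^sup>2 + 1\<^sup>2))-lipschitz_on UNIV (\<lambda>z. (?\<pi> (fst z), ?\<pi> (snd z)))"
      using lipschitz_on_Pair by fastforce
    then show ?thesis
      using lipschitz_on_compose2[OF _ lipschitz_on_subset[OF L]] in\<pi> by fastforce
  qed
  then obtain L' where "L'-lipschitz_on UNIV F"
    using lipschitz_on_Pair[OF snd] by (fastforce simp: F_def case_prod_unfold)
  then obtain y where y0: "y 0 = (q0, w0)" and y: "\<And>t. (y has_vector_derivative F (y t)) (at t)"
    using lipschitz_ode_global_solution by blast
  define Q W where "Q t = fst (y t)" and "W t = snd (y t)" for t
  have Q: "(Q has_vector_derivative W t) (at t)" for t
    using bounded_linear.has_vector_derivative[OF bounded_linear_fst y, of t]
    by (simp add: Q_def[abs_def] W_def F_def case_prod_unfold)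
  have W: "(W has_vector_derivative A (?\<pi> (Q t)) (?\<pi> (W t))) (at t)" for t
    using bounded_linear.has_vector_derivative[OF bounded_linear_snd y, of t]
    by (simp add: Q_def W_def[abs_def] F_def case_prod_unfold)
  \<comment> \<open>The projected velocity is \<open>s *\<^sub>R W t\<close>; homogeneity pulls
    \<open>s\<close> out of the force and skewness kills what remains.\<close>
  have "((\<lambda>t. N (W t) (W t)) has_vector_derivative 0) (at t)" for t
  proof -
    obtain s where s: "?\<pi> (W t) = s *\<^sub>R W t"
      using closest_point_cball_0 \<open>R \<ge> 0\<close> by blast
    show ?thesis
      using N.has_vector_derivative[OF W W, of t]
      by (simp add: s hom N.scaleR_right N.scaleR_left skew N(2)[of "A (?\<pi> (Q t)) (W t)"])
  qed
  then obtain e where "\<And>t. N (W t) (W t) = e"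
    using has_vector_derivative_zero_constant[of UNIV "\<lambda>t. N (W t) (W t)"] by auto
  then have NW: "N (W t) (W t) = N w0 w0" for t
    by (metis W_def y0 snd_conv)
  have normW: "norm (W t) \<le> E" for t
  proof -
    have "(norm (W t))\<^sup>2 \<le> N w0 w0 / m"
      using N(4)[of "W t"] N(3) by (simp add: NW field_simps)
    then show ?thesis by (simp add: E_def real_le_rsqrt)
  qed
  have normQ: "norm (Q t) \<le> norm q0 + E * \<bar>t\<bar>" for t
  proof -
    have "norm (Q t - Q 0) \<le> E * norm (t - 0)"
    proof (rule differentiable_bound[of UNIV Q "\<lambda>t x. x *\<^sub>R W t"])
      show "onorm (\<lambda>x. x *\<^sub>R W t) \<le> E" for t
        by (rule onorm_le) (use normW[of t] in \<open>simp add: mult.commute[of E] mult_left_mono\<close>)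
    qed (use Q in \<open>auto simp: has_vector_derivative_def\<close>)
    then show ?thesis
      using norm_triangle_sub[of "Q t" "Q 0"] by (simp add: Q_def y0)
  qed
  show "\<exists>y. y 0 = (q0, w0) \<and> (\<forall>t. \<bar>t\<bar> < real k \<longrightarrow>
      (y has_vector_derivative (case y t of (q, w) \<Rightarrow> (w, A q w))) (at t))"
  proof (intro exI conjI allI impI)
    fix t :: real
    assume "\<bar>t\<bar> < real k"
    then have "E * \<bar>t\<bar> \<le> E * real k"
      using \<open>E \<ge> 0\<close> by (intro mult_left_mono) auto
    then have "norm (Q t) \<le> R"
      using normQ[of t] \<open>E \<ge> 0\<close> by (simp add: R_def)
    moreover have "norm (W t) \<le> R"
      using normW \<open>E \<le> R\<close> order_trans by blast
    ultimately show "(y has_vector_derivative (case y t of (q, w) \<Rightarrow> (w, A q w))) (at t)"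
      using y[of t] by (simp add: F_def case_prod_unfold Q_def W_def closest_point_self)
  qed (rule y0)
qed (use that in auto)

section \<open>Partial derivatives and smooth functions\<close>

lemma pderiv_at_eqI:
  assumes "(f has_derivative f') (at p)"
  shows "pderiv_at i f p = f' (coord i)"
  using frechet_derivative_at[OF assms] by (simp add: pderiv_at_def)

lemma pderiv_at_const [simp]: "pderiv_at i (\<lambda>q. k) p = 0"
  by (rule pderiv_at_eqI[of _ "\<lambda>_. 0"]) simp

lemma pderiv_at_add:
  assumes "f differentiable at p" "g differentiable at p"
  shows "pderiv_at i (\<lambda>q. f q + g q) p = pderiv_at i f p + pderiv_at i g p"
  using pderiv_at_eqI[OF has_derivative_add[OF assms[unfolded frechet_derivative_works]]]
  by (simp add: pderiv_at_def)

lemma pderiv_at_diff: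
  assumes "f differentiable at p" "g differentiable at p"
  shows "pderiv_at i (\<lambda>q. f q - g q) p = pderiv_at i f p - pderiv_at i g p"
  using pderiv_at_eqI[OF has_derivative_diff[OF assms[unfolded frechet_derivative_works]]]
  by (simp add: pderiv_at_def)

lemma pderiv_at_mult:
  fixes f g :: "real ^ 'd::finite \<Rightarrow> real"
  assumes "f differentiable at p" "g differentiable at p"
  shows "pderiv_at i (\<lambda>q. f q * g q) p = pderiv_at i f p * g p + f p * pderiv_at i g p"
  using pderiv_at_eqI[OF has_derivative_mult[OF assms[unfolded frechet_derivative_works]]]
  by (simp add: pderiv_at_def)

lemma pderiv_at_bounded_linear:
  assumes "bounded_linear L" "f differentiable at p"
  shows "pderiv_at i (\<lambda>q. L (f q)) p = L (pderiv_at i f p)"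
  using pderiv_at_eqI[OF bounded_linear.has_derivative[OF assms(1) assms(2)[unfolded frechet_derivative_works]]]
  by (simp add: pderiv_at_def)

lemma frechet_derivative_eq_pderiv_sum:
  fixes f :: "real ^ 'd::finite \<Rightarrow> 'b::real_normed_vector"
  assumes "f differentiable at p"
  shows "frechet_derivative f (at p) a = (\<Sum>i\<in>UNIV. (a $ i) *\<^sub>R pderiv_at i f p)"
proof -
  interpret linear "frechet_derivative f (at p)"
    using assms by (rule linear_frechet_derivative)
  have "a = (\<Sum>i\<in>UNIV. (a $ i) *\<^sub>R coord i)"
    by (simp add: basis_expansion scalar_mult_eq_scaleR[symmetric])
  then have "frechet_derivative f (at p) a = frechet_derivative f (at p) (\<Sum>i\<in>UNIV. (a $ i) *\<^sub>R coord i)"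
    by simp
  then show ?thesis
    by (simp add: sum scale pderiv_at_def)
qed

lemma pderiv_at_translation_invariant:
  fixes f :: "real ^ 'd::finite \<Rightarrow> 'b::real_normed_vector"
  assumes "\<And>q. f (q + e) = f q" and "f differentiable at p"
  shows "pderiv_at i f (p + e) = pderiv_at i f p"
proof -
  have "(f has_derivative frechet_derivative f (at p)) (at p)"
    using assms(2) frechet_derivative_works by blast
  then have "((\<lambda>q. f (q - e)) has_derivative frechet_derivative f (at p)) (at (p + e))"
    by (intro has_derivative_compose[of "\<lambda>q. q - e" "\<lambda>h. h", where g = f]) (auto intro!: derivative_eq_intros)
  moreover have "(\<lambda>q. f (q - e)) = f"
    using assms(1)[of "_ - e"] by auto
  ultimately show ?thesis
    using pderiv_at_eqI by (metis pderiv_at_def)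
qed

lemma pderiv_at_eq_0_of_translation_invariant:
  fixes f :: "real ^ 'd::finite \<Rightarrow> 'b::real_normed_vector"
  assumes inv: "\<And>q t. f (q + t *\<^sub>R coord i) = f q" and f: "f differentiable at p"
  shows "pderiv_at i f p = 0"
proof -
  have "(f has_derivative frechet_derivative f (at p)) (at (p + 0 *\<^sub>R coord i))"
    using f frechet_derivative_works by auto
  then have "((\<lambda>t::real. f (p + t *\<^sub>R coord i)) has_derivative
      (\<lambda>t. frechet_derivative f (at p) (t *\<^sub>R coord i))) (at 0)"
    by (intro has_derivative_compose[of "\<lambda>t. p + t *\<^sub>R coord i" "\<lambda>t. t *\<^sub>R coord i", where g = f])
       (auto intro!: derivative_eq_intros)
  then have "((\<lambda>t::real. f p) has_derivative (\<lambda>t. frechet_derivative f (at p) (t *\<^sub>R coord i))) (at 0)"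
    by (simp add: inv)
  then have "(\<lambda>t. frechet_derivative f (at p) (t *\<^sub>R coord i)) = (\<lambda>t::real. 0)"
    using has_derivative_unique has_derivative_const by blast
  then have "frechet_derivative f (at p) (1 *\<^sub>R coord i) = 0" by meson
  then show ?thesis by (simp add: pderiv_at_def)
qed

lemma translation_invariant_of_pderiv_at_eq_0:
  fixes f :: "real ^ 'd::finite \<Rightarrow> 'b::real_normed_vector"
  assumes "\<And>q. pderiv_at i f q = 0" and f: "\<And>q. f differentiable at q"
  shows "f (q + t *\<^sub>R coord i) = f q"
proof -
  have "((\<lambda>s::real. f (q + s *\<^sub>R coord i)) has_derivative (\<lambda>h. 0)) (at s within UNIV)" for s
  proof -
    let ?D = "frechet_derivative f (at (q + s *\<^sub>R coord i))"
    interpret linear ?D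
      using f by (rule linear_frechet_derivative)
    have "((\<lambda>s::real. f (q + s *\<^sub>R coord i)) has_derivative (\<lambda>h. ?D (h *\<^sub>R coord i))) (at s)"
      using f frechet_derivative_works
      by (intro has_derivative_compose[of "\<lambda>s. q + s *\<^sub>R coord i" "\<lambda>h. h *\<^sub>R coord i", where g = f])
         (auto intro!: derivative_eq_intros)
    then show ?thesis
      using assms(1) by (simp add: scale pderiv_at_def)
  qed
  from has_derivative_zero_unique[OF convex_UNIV this, of t 0]
  show ?thesis by simp
qed

section \<open>Closure properties of smooth functions and local Lipschitz bounds\<close>

lemma C_k_Suc_D: "C_k (Suc k) f \<Longrightarrow> C_k k f"
proof (induction k arbitrary: f)
  case 0
  then show ?case
    by (auto intro!: continuous_at_imp_continuous_on differentiable_imp_continuous_within)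
next
  case (Suc k)
  then show ?case by (metis C_k.simps(2))
qed

lemma C_k_add: "C_k k f \<Longrightarrow> C_k k g \<Longrightarrow> C_k k (\<lambda>p. f p + g p)"
proof (induction k arbitrary: f g)
  case 0
  then show ?case by (auto intro: continuous_intros)
next
  case (Suc k)
  then have "pderiv_at i (\<lambda>p. f p + g p) = (\<lambda>p. pderiv_at i f p + pderiv_at i g p)" for i
    by (intro ext pderiv_at_add) auto
  then show ?case using Suc by (auto intro: derivative_intros)
qed

lemma C_k_mult:
  fixes f g :: "real ^ 'd::finite \<Rightarrow> real"
  shows "C_k k f \<Longrightarrow> C_k k g \<Longrightarrow> C_k k (\<lambda>p. f p * g p)"
proof (induction k arbitrary: f g)
  case 0
  then show ?case by (auto intro: continuous_intros)
next
  case (Suc k)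
  then have "pderiv_at i (\<lambda>p. f p * g p) = (\<lambda>p. pderiv_at i f p * g p + f p * pderiv_at i g p)" for i
    by (intro ext pderiv_at_mult) auto
  \<comment> \<open>The product rule also contains the undifferentiated factors, so the induction
    needs their regularity at the lower order.\<close>
  moreover have "C_k k f" "C_k k g"
    using Suc.prems C_k_Suc_D by blast+
  ultimately show ?case using Suc by (auto intro!: derivative_intros C_k_add)
qed

lemma C_k_bounded_linear:
  assumes L: "bounded_linear L"
  shows "C_k k f \<Longrightarrow> C_k k (\<lambda>p. L (f p))"
proof (induction k arbitrary: f)
  case 0
  then show ?case using L by (auto intro: bounded_linear.continuous_on)
next
  case (Suc k)
  then have "pderiv_at i (\<lambda>p. L (f p)) = (\<lambda>p. L (pderiv_at i f p))" for i
    by (intro ext pderiv_at_bounded_linear L) auto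
  moreover have "(\<lambda>p. L (f p)) differentiable at p" for p
    using Suc.prems L unfolding differentiable_def C_k.simps
    by (blast intro: bounded_linear.has_derivative)
  ultimately show ?case using Suc by auto
qed

lemma C_k_const: "C_k k (\<lambda>p. a)"
proof (induction k arbitrary: a)
  case (Suc k)
  have "pderiv_at i (\<lambda>p. a) = (\<lambda>p. 0)" for i :: 'a
    by (rule ext) simp
  then show ?case using Suc by simp
qed simp

lemma smooth_const [simp]: "smooth (\<lambda>p. a)"
  by (simp add: smooth_def C_k_const)

lemma smooth_add: "smooth f \<Longrightarrow> smooth g \<Longrightarrow> smooth (\<lambda>p. f p + g p)"
  by (simp add: smooth_def C_k_add)

lemma smooth_mult:
  fixes f g :: "real ^ 'd::finite \<Rightarrow> real"
  shows "smooth f \<Longrightarrow> smooth g \<Longrightarrow> smooth (\<lambda>p. f p * g p)"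
  by (simp add: smooth_def C_k_mult)

lemma smooth_bounded_linear: "bounded_linear L \<Longrightarrow> smooth f \<Longrightarrow> smooth (\<lambda>p. L (f p))"
  by (simp add: smooth_def C_k_bounded_linear)

lemma smooth_pderiv_at: "smooth f \<Longrightarrow> smooth (pderiv_at i f)"
  unfolding smooth_def by (metis C_k.simps(2))

lemma smooth_differentiable: "smooth f \<Longrightarrow> f differentiable at p"
  unfolding smooth_def by (metis C_k.simps(2))

lemma smooth_continuous: "smooth f \<Longrightarrow> continuous_on S f"
  unfolding smooth_def by (metis C_k.simps(1) continuous_on_subset subset_UNIV)

text \<open>The operator norm of the derivative is at most the sum of the norms of the partial
  derivatives, which is bounded on the compact ball; convexity of the ball then gives the mean value
  inequality.\<close>

lemma smooth_lipschitz_on_cball: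
  fixes f :: "real ^ 'd::finite \<Rightarrow> 'b::real_normed_vector"
  assumes "smooth f"
  shows "\<exists>L. L-lipschitz_on (cball 0 R) f"
proof -
  define S where "S = (\<lambda>p. \<Sum>i\<in>UNIV. norm (pderiv_at i f p)) ` cball 0 R"
  have "compact S"
    unfolding S_def
    by (intro compact_continuous_image continuous_intros smooth_continuous smooth_pderiv_at assms) auto
  then obtain B where "\<forall>x\<in>S. \<bar>x\<bar> \<le> B"
    using compact_imp_bounded bounded_real by metis
  then have B: "(\<Sum>i\<in>UNIV. norm (pderiv_at i f p)) \<le> B" if "p \<in> cball 0 R" for p
    using that by (force simp: S_def)
  have "onorm (frechet_derivative f (at p)) \<le> B" if "p \<in> cball 0 R" for p
  proof (rule onorm_le)
    fix h :: "real ^ 'd"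
    have "norm (frechet_derivative f (at p) h) \<le> (\<Sum>i\<in>UNIV. norm (pderiv_at i f p) * norm h)"
      unfolding frechet_derivative_eq_pderiv_sum[OF smooth_differentiable[OF assms]]
      by (rule sum_norm_le)
         (use component_le_norm_cart[of h] in \<open>auto simp: mult.commute[of _ "norm h"] intro!: mult_right_mono\<close>)
    also have "\<dots> \<le> B * norm h"
      using B[OF that] by (simp add: mult_right_mono flip: sum_distrib_right)
    finally show "norm (frechet_derivative f (at p) h) \<le> B * norm h" .
  qed
  then have "norm (f x - f y) \<le> B * norm (x - y)" if "x \<in> cball 0 R" "y \<in> cball 0 R" for x y
    using that smooth_differentiable[OF assms] frechet_derivative_works has_derivative_at_withinI
    by (intro differentiable_bound[OF convex_cball]) blast+
  \<comment> \<open>For negative \<open>R\<close> the ball is empty and \<open>B\<close> may be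
    negative, while a Lipschitz constant must not be.\<close>
  then have "(max 0 B)-lipschitz_on (cball 0 R) f"
    by (intro lipschitz_onI) (auto simp: dist_norm intro: order_trans[OF _ mult_right_mono[of B "max 0 B"]])
  then show ?thesis by blast
qed

lemma matrix_inv_eqI:
  assumes "A ** B = mat 1" "B ** A = mat 1"
  shows "matrix_inv A = B"
proof -
  have "\<exists>X. A ** X = mat 1 \<and> X ** A = mat 1" using assms by blast
  then have X: "A ** matrix_inv A = mat 1 \<and> matrix_inv A ** A = mat 1"
    unfolding matrix_inv_def by (rule someI_ex)
  then have "matrix_inv A = matrix_inv A ** (A ** B)"
    by (simp add: assms)
  also have "\<dots> = B"
    using X by (simp add: matrix_mul_assoc)
  finally show ?thesis .
qed

lemma smooth_scaleR: "smooth f \<Longrightarrow> smooth (\<lambda>p. f p *\<^sub>R w)" for w :: "'b::real_normed_vector"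
  by (rule smooth_bounded_linear[OF bounded_linear_scaleR_left])

lemma lipschitz_on_mult:
  fixes f g :: "'a::metric_space \<Rightarrow> real"
  assumes f: "L-lipschitz_on S f" "\<And>x. x \<in> S \<Longrightarrow> \<bar>f x\<bar> \<le> B"
    and g: "M-lipschitz_on S g" "\<And>x. x \<in> S \<Longrightarrow> \<bar>g x\<bar> \<le> C"
    and "B \<ge> 0" "C \<ge> 0"
  shows "(B * M + C * L)-lipschitz_on S (\<lambda>x. f x * g x)"
proof (rule lipschitz_onI)
  have "L \<ge> 0" "M \<ge> 0" using f g lipschitz_on_nonneg by auto
  then show "0 \<le> B * M + C * L" using assms(5,6) by simp
  fix x y
  assume xy: "x \<in> S" "y \<in> S"
  have "f x * g x - f y * g y = f x * (g x - g y) + g y * (f x - f y)"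
    by (simp add: algebra_simps)
  then have "dist (f x * g x) (f y * g y) \<le> \<bar>f x\<bar> * \<bar>g x - g y\<bar> + \<bar>g y\<bar> * \<bar>f x - f y\<bar>"
    by (metis abs_mult abs_triangle_ineq dist_real_def)
  also have "\<dots> \<le> B * (M * dist x y) + C * (L * dist x y)"
    using f(2)[OF xy(1)] g(2)[OF xy(2)] lipschitz_onD[OF f(1) xy] lipschitz_onD[OF g(1) xy] assms(5,6)
    by (intro add_mono mult_mono) (auto simp: dist_real_def)
  finally show "dist (f x * g x) (f y * g y) \<le> (B * M + C * L) * dist x y"
    by (simp add: algebra_simps)
qed

lemma lipschitz_on_sum:
  fixes f :: "'i \<Rightarrow> 'a::metric_space \<Rightarrow> 'b::real_normed_vector"
  assumes "\<And>i. i \<in> K \<Longrightarrow> \<exists>L. L-lipschitz_on S (f i)"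
  shows "\<exists>L. L-lipschitz_on S (\<lambda>x. \<Sum>i\<in>K. f i x)"
  using assms
proof (induction K rule: infinite_finite_induct)
  case (insert i K)
  obtain L where "L-lipschitz_on S (f i)"
    using insert.prems by blast
  moreover obtain M where "M-lipschitz_on S (\<lambda>x. \<Sum>i\<in>K. f i x)"
    using insert by blast
  ultimately show ?case
    using insert.hyps lipschitz_on_add by fastforce
qed (auto intro: exI[of _ 0] simp: lipschitz_on_def)

lemma has_vector_derivative_nth:
  assumes "(f has_vector_derivative f') F"
  shows "((\<lambda>t. f t $ i) has_vector_derivative f' $ i) F"
  by (rule bounded_linear.has_vector_derivative[OF bounded_linear_vec_nth assms])

section \<open>The metric and its curvature\<close>

lemma sum_UNIV_split:
  fixes f :: "'d::finite \<Rightarrow> 'b::comm_monoid_add"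
  assumes "v \<noteq> u"
  shows "sum f UNIV = f v + (f u + sum f (- {v, u}))"
proof -
  have "sum f (insert v (insert u (- {v, u}))) = f v + (f u + sum f (- {v, u}))"
    using assms by simp
  moreover have "insert v (insert u (- {v, u})) = UNIV" by auto
  ultimately show ?thesis by simp
qed

text \<open>The metric only distinguishes the two indices \<open>v\<close> and \<open>u\<close>; the
  numbering of the transverse coordinates enters with \<open>J\<close>. Independence of
  \<open>v\<close> is phrased as translation invariance, the form in which it passes to the
  derivatives of \<open>H\<close>.\<close>

locale pp_metric =
  fixes v u :: "'d::finite" and H :: "real ^ 'd \<Rightarrow> real"
  assumes vu: "v \<noteq> u" and smooth_H: "smooth H"
    and H_translate: "\<And>p t. H (p + t *\<^sub>R coord v) = H p"
begin

lemma uv: "u \<noteq> v" using vu by simp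

text \<open>The completed square makes positivity visible. Its factor
  \<open>2 * a $ v + H p * a $ u\<close> is the pairing of \<open>a\<close> with the Killing field
  of the \<open>v\<close> direction, later the conserved momentum.\<close>

definition g :: "'d bilin_field"
  where "g p a b = (2 * a $ v + H p * a $ u) * (2 * b $ v + H p * b $ u) / 2
    + a $ u * b $ u / 2 + (\<Sum>i\<in>- {v, u}. a $ i * b $ i)"

text \<open>\<open>lower\<close> and \<open>upper\<close> tabulate the metric matrix and its inverse
  as functions of the value \<open>h\<close> of \<open>H\<close>, and \<open>dlower\<close> is the
  derivative of \<open>lower\<close> in \<open>h\<close>. The \<open>(v, u)\<close>-block has
  determinant one, so the inverse has no denominators.\<close>

definition lower :: "real \<Rightarrow> 'd \<Rightarrow> 'd \<Rightarrow> real"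
  where "lower h i j = (if i = v \<and> j = v then 2 else if i = v \<and> j = u \<or> i = u \<and> j = v then h
    else if i = u \<and> j = u then (1 + h\<^sup>2) / 2 else if i = j then 1 else 0)"

definition upper :: "real \<Rightarrow> 'd \<Rightarrow> 'd \<Rightarrow> real"
  where "upper h i j = (if i = v \<and> j = v then (1 + h\<^sup>2) / 2 else if i = v \<and> j = u \<or> i = u \<and> j = v then - h
    else if i = u \<and> j = u then 2 else if i = j then 1 else 0)"

definition dlower :: "real \<Rightarrow> 'd \<Rightarrow> 'd \<Rightarrow> real"
  where "dlower h i j = (if i = v \<and> j = u \<or> i = u \<and> j = v then 1 else if i = u \<and> j = u then h else 0)"

text \<open>The matrix product of \<open>upper h\<close> and \<open>dlower h\<close>, that is, the
  \<open>h\<close>-derivative of the metric with one index raised; \<open>dmixed\<close> is its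
  derivative in \<open>h\<close>.\<close>

definition mixed :: "real \<Rightarrow> 'd \<Rightarrow> 'd \<Rightarrow> real"
  where "mixed h k j = (if k = v \<and> j = v then - h else if k = v \<and> j = u then (1 - h\<^sup>2) / 2
    else if k = u \<and> j = v then 2 else if k = u \<and> j = u then h else 0)"

definition dmixed :: "real \<Rightarrow> 'd \<Rightarrow> 'd \<Rightarrow> real"
  where "dmixed h k j = (if k = v \<and> j = v then - 1 else if k = v \<and> j = u then - h
    else if k = u \<and> j = u then 1 else 0)"

abbreviation dH :: "'d \<Rightarrow> real ^ 'd \<Rightarrow> real"
  where "dH i \<equiv> pderiv_at i H"

abbreviation ddH :: "'d \<Rightarrow> 'd \<Rightarrow> real ^ 'd \<Rightarrow> real"
  where "ddH i j \<equiv> pderiv_at i (pderiv_at j H)"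

text \<open>The gradient of \<open>H\<close>: the differential with its index raised by
  \<open>upper\<close>, where the \<open>v\<close>-derivative has been dropped because it
  vanishes.\<close>

definition grad :: "'d \<Rightarrow> real ^ 'd \<Rightarrow> real"
  where "grad k p = (if k = v then - (H p * dH u p) else if k = u then 2 * dH u p else dH k p)"

lemma H_diff: "H differentiable at p"
  by (rule smooth_differentiable[OF smooth_H])

lemma dH_diff: "dH i differentiable at p"
  by (rule smooth_differentiable[OF smooth_pderiv_at[OF smooth_H]])

lemma dH_v: "dH v = (\<lambda>p. 0)"
  by (rule ext, rule pderiv_at_eq_0_of_translation_invariant[OF H_translate H_diff])

text \<open>\<open>dH i\<close> inherits the invariance of \<open>H\<close> along \<open>v\<close>,
  so the first identity does not go through symmetry of second derivatives.\<close>

lemma ddH_v [simp]: "ddH v i p = 0" "ddH i v p = 0"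
proof -
  show "ddH v i p = 0"
    by (rule pderiv_at_eq_0_of_translation_invariant[OF pderiv_at_translation_invariant[OF H_translate H_diff] dH_diff])
  show "ddH i v p = 0"
    by (simp add: dH_v)
qed

lemma dH_v' [simp]: "dH v p = 0"
  by (simp add: dH_v)

lemma g_coord: "g p (coord i) (coord j) = lower (H p) i j"
proof -
  have "(\<Sum>k\<in>- {v, u}. coord i $ k * coord j $ k) = (if i = j \<and> i \<noteq> v \<and> i \<noteq> u then 1 else (0::real))"
  proof -
    have "(\<Sum>k\<in>- {v, u}. coord i $ k * coord j $ k) = (\<Sum>k\<in>- {v, u}. if k = i then (if i = j then 1 else (0::real)) else 0)"
      by (rule sum.cong) (auto simp: axis_def)
    then show ?thesis by simp
  qed
  then show ?thesis
    using vu by (auto simp: g_def lower_def axis_def power2_eq_square field_simps)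
qed

lemma sum_upper:
  "(\<Sum>l\<in>UNIV. upper h k l * X l) = (if k = v then (1 + h\<^sup>2) / 2 * X v - h * X u
    else if k = u then 2 * X u - h * X v else X k)"
proof -
  have "(\<Sum>l\<in>- {v, u}. upper h k l * X l) = (\<Sum>l\<in>- {v, u}. if k = l then X l else 0)"
    by (rule sum.cong) (auto simp: upper_def)
  then show ?thesis
    using vu uv by (simp add: sum_UNIV_split[OF vu]) (auto simp: upper_def)
qed

lemma lower_sym: "lower h i j = lower h j i"
  by (cases "i = j"; cases "i = v"; cases "i = u"; cases "j = v"; cases "j = u";
      simp add: lower_def vu uv)

lemma upper_sym: "upper h i j = upper h j i"
  by (cases "i = j"; cases "i = v"; cases "i = u"; cases "j = v"; cases "j = u";
      simp add: upper_def vu uv)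

lemma upper_lower: "(\<Sum>l\<in>UNIV. upper h i l * lower h l j) = (if i = j then 1 else 0)"
  using vu uv by (auto simp: sum_upper lower_def power2_eq_square field_simps)

lemma inv_metric_g: "inv_metric g p = (\<chi> i j. upper (H p) i j)"
  unfolding inv_metric_def
proof (rule matrix_inv_eqI)
  show "(\<chi> i j. upper (H p) i j) ** (\<chi> i j. g p (coord i) (coord j)) = mat 1"
    by (simp add: vec_eq_iff matrix_matrix_mult_def mat_def g_coord upper_lower)
  have "(\<Sum>l\<in>UNIV. lower (H p) i l * upper (H p) l j) = (\<Sum>l\<in>UNIV. upper (H p) j l * lower (H p) l i)" for i j
    by (rule sum.cong[OF refl]) (metis lower_sym upper_sym mult.commute)
  then have "(\<Sum>l\<in>UNIV. lower (H p) i l * upper (H p) l j) = (if i = j then 1 else 0)" for i j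
    by (simp add: upper_lower)
  then show "(\<chi> i j. g p (coord i) (coord j)) ** (\<chi> i j. upper (H p) i j) = mat 1"
    by (simp add: vec_eq_iff matrix_matrix_mult_def mat_def g_coord)
qed

section \<open>Christoffel symbols and their derivatives\<close>

lemma pderiv_H_square: "pderiv_at k (\<lambda>q. (H q)\<^sup>2) p = 2 * H p * dH k p"
  using pderiv_at_mult[OF H_diff H_diff] by (simp add: power2_eq_square)

lemma pderiv_affine:
  assumes "f differentiable at p"
  shows "pderiv_at k (\<lambda>q. a + b * f q) p = (b * pderiv_at k f p :: real)"
  using pderiv_at_bounded_linear[OF bounded_linear_mult_right[of b] assms]
    pderiv_at_add[of "\<lambda>q. a" p "\<lambda>q. b * f q"] assms by (simp add: differentiable_mult)

lemma pderiv_g: "pderiv_at k (\<lambda>q. g q (coord i) (coord j)) p = dH k p * dlower (H p) i j"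
proof -
  have "pderiv_at k (\<lambda>q. (1 + (H q)\<^sup>2) / 2) p = H p * dH k p"
    using pderiv_affine[of "\<lambda>q. (H q)\<^sup>2" p k "1/2" "1/2"] differentiable_power[OF H_diff]
    by (simp add: pderiv_H_square add_divide_distrib)
  then show ?thesis
    using vu uv by (cases "i = v"; cases "i = u"; cases "j = v"; cases "j = u";
      simp add: g_coord lower_def dlower_def)
qed

text \<open>Every derivative of a metric coefficient is a derivative of \<open>H\<close> times
  \<open>dlower\<close>. Raising the index therefore produces \<open>mixed\<close> in the first two
  terms and the gradient of \<open>H\<close> in the third.\<close>

lemma christoffel_g: "christoffel g k i j = (\<lambda>p. (1/2) *
    (dH i p * mixed (H p) k j + dH j p * mixed (H p) k i - grad k p * dlower (H p) i j))"
proof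
  fix p
  show "christoffel g k i j p = (1/2) *
    (dH i p * mixed (H p) k j + dH j p * mixed (H p) k i - grad k p * dlower (H p) i j)"
    using vu uv
    by (simp only: christoffel_def inv_metric_g pderiv_g vec_lambda_beta sum_upper,
      cases "k = v"; cases "k = u"; cases "i = v"; cases "i = u"; cases "j = v"; cases "j = u";
      simp add: grad_def mixed_def dlower_def power2_eq_square field_simps)
qed

lemma mixed_diff: "(\<lambda>q. mixed (H q) k j) differentiable at p"
  and dlower_diff: "(\<lambda>q. dlower (H q) k j) differentiable at p"
  and grad_diff: "grad k differentiable at p"
  subgoal using vu uv by (cases "k = v"; cases "k = u"; cases "j = v"; cases "j = u";
      auto simp: mixed_def intro!: derivative_intros H_diff dH_diff)
  subgoal using vu uv by (cases "k = v"; cases "k = u"; cases "j = v"; cases "j = u";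
      auto simp: dlower_def intro!: derivative_intros H_diff dH_diff)
  subgoal using vu uv by (cases "k = v"; cases "k = u";
      auto simp: grad_def[abs_def] intro!: derivative_intros H_diff dH_diff)
  done

lemma pderiv_mixed: "pderiv_at l (\<lambda>q. mixed (H q) k j) p = dH l p * dmixed (H p) k j"
  using vu uv pderiv_affine[of H p l 0 "-1"] H_diff
    pderiv_affine[of "\<lambda>q. (H q)\<^sup>2" p l "1/2" "-1/2"] differentiable_power[OF H_diff]
  by (cases "k = v"; cases "k = u"; cases "j = v"; cases "j = u";
      simp add: mixed_def dmixed_def pderiv_H_square diff_divide_distrib)

lemma pderiv_dlower: "pderiv_at l (\<lambda>q. dlower (H q) i j) p = (if i = u \<and> j = u then dH l p else 0)"
  using vu uv by (cases "i = v"; cases "i = u"; cases "j = v"; cases "j = u"; simp add: dlower_def)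

lemma pderiv_grad: "pderiv_at l (grad k) p = (if k = v then - (dH l p * dH u p + H p * ddH l u p)
    else if k = u then 2 * ddH l u p else ddH l k p)"
proof -
  have "pderiv_at l (\<lambda>q. - (H q * dH u q)) p = - (dH l p * dH u p + H p * ddH l u p)"
    using pderiv_affine[OF differentiable_mult[OF H_diff dH_diff], where a = 0 and b = "-1"]
    by (simp add: pderiv_at_mult H_diff dH_diff)
  moreover have "pderiv_at l (\<lambda>q. 2 * dH u q) p = 2 * ddH l u p"
    using pderiv_affine[OF dH_diff, where a = 0 and b = 2] by simp
  ultimately show ?thesis
    using vu uv by (cases "k = v"; cases "k = u"; simp add: grad_def[abs_def])
qed

lemma pderiv_christoffel_g: "pderiv_at l (christoffel g k i j) p = (1/2) *
    (ddH l i p * mixed (H p) k j + dH i p * (dH l p * dmixed (H p) k j)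
    + (ddH l j p * mixed (H p) k i + dH j p * (dH l p * dmixed (H p) k i))
    - (pderiv_at l (grad k) p * dlower (H p) i j + grad k p * (if i = u \<and> j = u then dH l p else 0)))"
proof -
  note diff = mixed_diff dlower_diff grad_diff dH_diff differentiable_mult differentiable_add differentiable_diff
  have "pderiv_at l (christoffel g k i j) p = (1/2) * pderiv_at l (\<lambda>q.
      dH i q * mixed (H q) k j + dH j q * mixed (H q) k i - grad k q * dlower (H q) i j) p"
    unfolding christoffel_g by (rule pderiv_affine[where a = 0, unfolded add_0]) (intro diff)
  then show ?thesis
    by (simp only: pderiv_at_add pderiv_at_diff pderiv_at_mult diff pderiv_mixed pderiv_dlower)
qed

section \<open>Ricci and scalar curvature\<close>

definition grad_sq :: "real ^ 'd \<Rightarrow> real"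
  where "grad_sq p = (\<Sum>i\<in>- {v, u}. (dH i p)\<^sup>2)"

definition lap :: "real ^ 'd \<Rightarrow> real"
  where "lap p = (\<Sum>i\<in>- {v, u}. ddH i i p)"

lemma christoffel_table:
  "christoffel g v u u p = dH u p / 2" "christoffel g u u u p = 0"
  "christoffel g v u v p = 0" "christoffel g u u v p = 0"
  "christoffel g v v u p = 0" "christoffel g u v u p = 0" "christoffel g k v v p = 0"
  "i \<in> - {v, u} \<Longrightarrow> christoffel g i u u p = - (H p * dH i p / 2)"
  "i \<in> - {v, u} \<Longrightarrow> christoffel g i u v p = - (dH i p / 2)"
  "i \<in> - {v, u} \<Longrightarrow> christoffel g i v u p = - (dH i p / 2)"
  "i \<in> - {v, u} \<Longrightarrow> christoffel g v u i p = (1 - (H p)\<^sup>2) * dH i p / 4"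
  "i \<in> - {v, u} \<Longrightarrow> christoffel g v i u p = (1 - (H p)\<^sup>2) * dH i p / 4"
  "i \<in> - {v, u} \<Longrightarrow> christoffel g v v i p = - (H p * dH i p / 2)"
  "i \<in> - {v, u} \<Longrightarrow> christoffel g v i v p = - (H p * dH i p / 2)"
  "i \<in> - {v, u} \<Longrightarrow> christoffel g u u i p = H p * dH i p / 2"
  "i \<in> - {v, u} \<Longrightarrow> christoffel g u i u p = H p * dH i p / 2"
  "i \<in> - {v, u} \<Longrightarrow> christoffel g u v i p = dH i p"
  "i \<in> - {v, u} \<Longrightarrow> christoffel g u i v p = dH i p"
  "i \<in> - {v, u} \<Longrightarrow> j \<in> - {v, u} \<Longrightarrow> christoffel g k i j p = 0"
  "i \<in> - {v, u} \<Longrightarrow> j \<in> - {v, u} \<Longrightarrow> christoffel g i j k p = 0"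
  "i \<in> - {v, u} \<Longrightarrow> j \<in> - {v, u} \<Longrightarrow> christoffel g i k j p = 0"
  using vu uv
  by (auto simp: christoffel_g mixed_def dlower_def grad_def power2_eq_square field_simps)

text \<open>This trace is the logarithmic derivative of the volume density, and the metric has
  determinant one.\<close>

lemma christoffel_trace: "(\<Sum>i\<in>UNIV. christoffel g i i k p) = 0"
  using vu uv by (cases "k \<in> - {v, u}") (auto simp: sum_UNIV_split[OF vu] christoffel_table)

lemma pderiv_christoffel_trace: "(\<Sum>i\<in>UNIV. pderiv_at l (christoffel g i i k) p) = 0"
proof -
  have "(\<Sum>i\<in>- {v, u}. pderiv_at l (christoffel g i i k) p) = 0"
    by (rule sum.neutral) (auto simp: pderiv_christoffel_g mixed_def dmixed_def dlower_def)
  then show ?thesis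
    using vu uv by (simp add: sum_UNIV_split[OF vu])
      (auto simp: pderiv_christoffel_g pderiv_grad mixed_def dmixed_def dlower_def grad_def power2_eq_square field_simps)
qed

text \<open>The two terms of the Ricci tensor that contain the trace of the Christoffel symbols drop
  out, leaving a divergence and a quadratic term.\<close>

lemma ricci_eq: "ricci g j k p = (\<Sum>i\<in>UNIV. pderiv_at i (christoffel g i j k) p)
    - (\<Sum>i\<in>UNIV. \<Sum>m\<in>UNIV. christoffel g i j m p * christoffel g m i k p)"
proof -
  have "(\<Sum>i\<in>UNIV. \<Sum>m\<in>UNIV. christoffel g i i m p * christoffel g m j k p)
      = (\<Sum>m\<in>UNIV. (\<Sum>i\<in>UNIV. christoffel g i i m p) * christoffel g m j k p)"
    by (subst sum.swap) (simp add: sum_distrib_right)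
  then show ?thesis
    by (simp add: ricci_def riemann_def sum.distrib sum_subtractf christoffel_trace pderiv_christoffel_trace)
qed

lemma pderiv_christoffel_table:
  "i \<in> - {v, u} \<Longrightarrow> pderiv_at i (christoffel g i v v) p = 0"
  "i \<in> - {v, u} \<Longrightarrow> pderiv_at i (christoffel g i v u) p = - (ddH i i p / 2)"
  "i \<in> - {v, u} \<Longrightarrow> pderiv_at i (christoffel g i u v) p = - (ddH i i p / 2)"
  "i \<in> - {v, u} \<Longrightarrow> pderiv_at i (christoffel g i u u) p = - (((dH i p)\<^sup>2 + H p * ddH i i p) / 2)"
  "i \<in> - {v, u} \<Longrightarrow> j \<in> - {v, u} \<Longrightarrow> pderiv_at i (christoffel g i j j) p = 0"
  using vu uv
  by (auto simp: pderiv_christoffel_g pderiv_grad mixed_def dmixed_def dlower_def grad_def power2_eq_square field_simps)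

text \<open>The scalar curvature contracts the Ricci tensor with \<open>upper\<close>, which couples
  only \<open>v\<close> with \<open>u\<close>. So the \<open>(v, u)\<close>-block and the transverse
  diagonal suffice, here and for the quadratic terms.\<close>

lemma divergence_table:
  "(\<Sum>i\<in>UNIV. pderiv_at i (christoffel g i v v) p) = 0"
  "(\<Sum>i\<in>UNIV. pderiv_at i (christoffel g i v u) p) = - lap p / 2"
  "(\<Sum>i\<in>UNIV. pderiv_at i (christoffel g i u v) p) = - lap p / 2"
  "(\<Sum>i\<in>UNIV. pderiv_at i (christoffel g i u u) p) = - (grad_sq p + H p * lap p) / 2"
  "j \<in> - {v, u} \<Longrightarrow> (\<Sum>i\<in>UNIV. pderiv_at i (christoffel g i j j) p) = 0"
  using vu uv
  by (simp_all add: sum_UNIV_split[OF vu] pderiv_christoffel_table lap_def grad_sq_def sum_distrib_left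
      sum_negf sum.distrib flip: sum_divide_distrib cong: sum.cong_simp)
     (auto simp: pderiv_christoffel_g pderiv_grad mixed_def dmixed_def dlower_def grad_def power2_eq_square
       algebra_simps)

lemma quadratic_table:
  "(\<Sum>i\<in>UNIV. \<Sum>m\<in>UNIV. christoffel g i v m p * christoffel g m i v p) = - grad_sq p"
  "(\<Sum>i\<in>UNIV. \<Sum>m\<in>UNIV. christoffel g i v m p * christoffel g m i u p) = - H p * grad_sq p / 2"
  "(\<Sum>i\<in>UNIV. \<Sum>m\<in>UNIV. christoffel g i u m p * christoffel g m i v p) = - H p * grad_sq p / 2"
  "(\<Sum>i\<in>UNIV. \<Sum>m\<in>UNIV. christoffel g i u m p * christoffel g m i u p) = - (1 + (H p)\<^sup>2) * grad_sq p / 4"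
  "j \<in> - {v, u} \<Longrightarrow> (\<Sum>i\<in>UNIV. \<Sum>m\<in>UNIV. christoffel g i j m p * christoffel g m i j p) = (dH j p)\<^sup>2 / 2"
proof -
  show "(\<Sum>i\<in>UNIV. \<Sum>m\<in>UNIV. christoffel g i v m p * christoffel g m i v p) = - grad_sq p"
    by (simp add: sum_UNIV_split[OF vu] christoffel_table grad_sq_def power2_eq_square sum_negf
        flip: sum_divide_distrib cong: sum.cong_simp)
  show "(\<Sum>i\<in>UNIV. \<Sum>m\<in>UNIV. christoffel g i v m p * christoffel g m i u p) = - H p * grad_sq p / 2"
    by (simp add: sum_UNIV_split[OF vu] christoffel_table grad_sq_def power2_eq_square
        sum_distrib_left sum_divide_distrib flip: sum.distrib sum_subtractf sum_negf cong: sum.cong_simp)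
  show "(\<Sum>i\<in>UNIV. \<Sum>m\<in>UNIV. christoffel g i u m p * christoffel g m i v p) = - H p * grad_sq p / 2"
    by (simp add: sum_UNIV_split[OF vu] christoffel_table grad_sq_def power2_eq_square
        sum_distrib_left sum_divide_distrib flip: sum.distrib sum_subtractf sum_negf cong: sum.cong_simp)
  show "(\<Sum>i\<in>UNIV. \<Sum>m\<in>UNIV. christoffel g i u m p * christoffel g m i u p) = - (1 + (H p)\<^sup>2) * grad_sq p / 4"
    by (simp add: sum_UNIV_split[OF vu] christoffel_table grad_sq_def power2_eq_square
        sum_distrib_left sum_divide_distrib flip: sum.distrib sum_subtractf sum_negf cong: sum.cong_simp)
       (rule sum.cong, simp_all add: field_simps)
  show "(\<Sum>i\<in>UNIV. \<Sum>m\<in>UNIV. christoffel g i j m p * christoffel g m i j p) = (dH j p)\<^sup>2 / 2"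
    if "j \<in> - {v, u}"
    using that
    by (simp add: sum_UNIV_split[OF vu] christoffel_table power2_eq_square cong: sum.cong_simp)
       (simp add: field_simps)
qed

text \<open>The transverse Laplacian \<open>lap\<close> occurs in the mixed and in the
  \<open>u u\<close> component of the Ricci tensor, and the two contributions cancel in the trace.
  Only first derivatives of \<open>H\<close> survive.\<close>

lemma scalar_curvature_g: "scalar_curvature g p = - grad_sq p / 2"
proof -
  have "(\<Sum>i\<in>- {v, u}. ricci g i i p) = (\<Sum>i\<in>- {v, u}. - ((dH i p)\<^sup>2 / 2))"
    by (rule sum.cong) (simp_all only: ricci_eq divergence_table quadratic_table)
  then have "(\<Sum>i\<in>- {v, u}. ricci g i i p) = - (grad_sq p / 2)"
    by (simp add: grad_sq_def sum_negf sum_divide_distrib)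
  then show ?thesis using vu uv
    by (simp add: scalar_curvature_def inv_metric_g sum_upper sum_UNIV_split[OF vu] cong: sum.cong)
       (simp add: ricci_eq divergence_table quadratic_table power2_eq_square field_simps)
qed

lemma scalar_flat_iff: "scalar_flat g \<longleftrightarrow> (\<forall>i. i \<noteq> u \<longrightarrow> dH i = (\<lambda>p. 0))"
proof -
  have "grad_sq p = 0 \<longleftrightarrow> (\<forall>i\<in>- {v, u}. dH i p = 0)" for p
    unfolding grad_sq_def by (subst sum_nonneg_eq_0_iff) auto
  then show ?thesis
    by (auto simp: scalar_flat_def scalar_curvature_g fun_eq_iff) (metis ComplI dH_v' insertE singletonD)
qed

lemma scalar_curvature_nonpos: "scalar_curvature g p \<le> 0"
  by (simp add: scalar_curvature_g grad_sq_def sum_nonneg)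

lemma scalar_flat_if_flat:
  assumes "flat_metric g"
  shows "scalar_flat g"
  using assms by (simp add: flat_metric_def scalar_flat_def scalar_curvature_def ricci_def)

lemma flat_if_scalar_flat:
  assumes "scalar_flat g"
  shows "flat_metric g"
proof -
  have dH: "dH i = (\<lambda>p. 0)" if "i \<noteq> u" for i
    using assms that by (simp add: scalar_flat_iff)
  \<comment> \<open>\<open>H\<close> is constant along \<open>i\<close>, hence so is
    \<open>dH u\<close>; this replaces an exchange of the order of differentiation.\<close>
  have ddH: "ddH i u p = 0" if "i \<noteq> u" for i p
    by (rule pderiv_at_eq_0_of_translation_invariant[OF pderiv_at_translation_invariant[OF
            translation_invariant_of_pderiv_at_eq_0 H_diff] dH_diff])
       (simp_all add: dH that H_diff)
  \<comment> \<open>The index \<open>v\<close> occurs only on top, so the quadratic curvature terms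
    vanish. The remaining symbol varies along \<open>u\<close> alone, and the two
    \<open>u\<close>-derivatives cancel by antisymmetry.\<close>
  have "christoffel g k i j = (if k = v \<and> i = u \<and> j = u then (\<lambda>p. dH u p / 2) else (\<lambda>p. 0))" for k i j
    using vu uv by (cases "i = u"; cases "j = u"; cases "k = v"; cases "k = u")
      (auto simp: christoffel_g grad_def mixed_def dlower_def dH power2_eq_square field_simps fun_eq_iff)
  moreover have "pderiv_at i (\<lambda>p. dH u p / 2) p = 0" if "i \<noteq> u" for i p
    using pderiv_affine[OF dH_diff[of u p], where a = 0 and b = "1/2" and k = i] that by (simp add: ddH)
  ultimately show ?thesis
    using uv by (auto simp: flat_metric_def riemann_def)
qed

section \<open>Smoothness and positivity of the metric\<close>

lemma smooth_affine_H: "smooth (\<lambda>p. a + b * H p)" "smooth (\<lambda>p. (1 + (H p)\<^sup>2) / 2)"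
proof -
  show "smooth (\<lambda>p. a + b * H p)" for a b :: real
    by (intro smooth_add smooth_mult smooth_const smooth_H)
  have "smooth (\<lambda>p. 1/2 + 1/2 * (H p * H p))"
    by (intro smooth_add smooth_mult smooth_const smooth_H)
  then show "smooth (\<lambda>p. (1 + (H p)\<^sup>2) / 2)"
    by (simp add: add_divide_distrib power2_eq_square)
qed

lemma riemannian_metric_g: "riemannian_metric g"
  unfolding riemannian_metric_def
proof (intro conjI allI impI)
  show "bilinear (g p)" for p
    unfolding bilinear_def
    by (auto intro!: linearI simp: g_def algebra_simps sum.distrib sum_distrib_left add_divide_distrib)
  show "g p a b = g p b a" for p a b
    by (simp add: g_def mult.commute)
  show "g p a a > 0" if "a \<noteq> 0" for p a
  proof (rule ccontr)
    assume "\<not> g p a a > 0"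
    moreover have "(\<Sum>i\<in>- {v, u}. (a $ i)\<^sup>2) \<ge> 0" "(2 * a $ v + H p * a $ u)\<^sup>2 \<ge> 0" "(a $ u)\<^sup>2 \<ge> 0"
      by (auto intro: sum_nonneg)
    ultimately have "(\<Sum>i\<in>- {v, u}. (a $ i)\<^sup>2) = 0" "(2 * a $ v + H p * a $ u)\<^sup>2 = 0" "(a $ u)\<^sup>2 = 0"
      unfolding g_def power2_eq_square by linarith+
    then have "\<forall>i\<in>- {v, u}. a $ i = 0" "a $ u = 0" "a $ v = 0"
      by (simp_all add: sum_nonneg_eq_0_iff)
    then have "a = 0" by (auto simp: vec_eq_iff)
    with that show False by simp
  qed
  show "smooth (\<lambda>p. g p (coord i) (coord j))" for i j
    unfolding g_coord using vu uv smooth_affine_H smooth_H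
    by (cases "i = v"; cases "i = u"; cases "j = v"; cases "j = u"; simp add: lower_def)
qed

subsection \<open>Geodesics\<close>

definition slope :: "real ^ 'd \<Rightarrow> real ^ 'd \<Rightarrow> real"
  where "slope p w = (\<Sum>i\<in>- {v, u}. dH i p * w $ i)"

definition accel :: "real ^ 'd \<Rightarrow> real ^ 'd \<Rightarrow> real ^ 'd"
  where "accel p w = (\<chi> k.
    if k = v then H p * slope p w * w $ v - dH u p / 2 * (w $ u)\<^sup>2 - (1 - (H p)\<^sup>2) / 2 * slope p w * w $ u
    else if k = u then - slope p w * (2 * w $ v + H p * w $ u)
    else dH k p * w $ u * (2 * w $ v + H p * w $ u) / 2)"

lemma geodesic_accel:
  "(\<chi> k. - (\<Sum>i\<in>UNIV. \<Sum>j\<in>UNIV. christoffel g k i j p * w $ i * w $ j)) = accel p w"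
proof -
  have S: "(\<Sum>i\<in>- {v, u}. c * dH i p * w $ i) = c * slope p w" for c
    by (simp add: slope_def sum_distrib_left mult.assoc)
  have v1: "(\<Sum>i\<in>- {v, u}. christoffel g v u i p * w $ i) = (1 - (H p)\<^sup>2) / 4 * slope p w"
    "(\<Sum>i\<in>- {v, u}. christoffel g v i u p * w $ i) = (1 - (H p)\<^sup>2) / 4 * slope p w"
    "(\<Sum>i\<in>- {v, u}. christoffel g v v i p * w $ i) = - H p / 2 * slope p w"
    "(\<Sum>i\<in>- {v, u}. christoffel g v i v p * w $ i) = - H p / 2 * slope p w"
    "(\<Sum>i\<in>- {v, u}. christoffel g u u i p * w $ i) = H p / 2 * slope p w"
    "(\<Sum>i\<in>- {v, u}. christoffel g u i u p * w $ i) = H p / 2 * slope p w"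
    "(\<Sum>i\<in>- {v, u}. christoffel g u v i p * w $ i) = slope p w"
    "(\<Sum>i\<in>- {v, u}. christoffel g u i v p * w $ i) = slope p w"
    "(\<Sum>i\<in>- {v, u}. \<Sum>j\<in>- {v, u}. christoffel g k i j p * w $ i * w $ j) = 0" for k
    unfolding S[symmetric] by (simp_all add: slope_def christoffel_table)
  \<comment> \<open>The double sum split into blocks; the block with both indices transverse is zero
    by the last identity in \<open>v1\<close>.\<close>
  have eq: "(\<Sum>i\<in>UNIV. \<Sum>j\<in>UNIV. christoffel g k i j p * w $ i * w $ j)
      = christoffel g k v v p * w $ v * w $ v + christoffel g k v u p * w $ v * w $ u
      + christoffel g k u v p * w $ u * w $ v + christoffel g k u u p * w $ u * w $ u
      + (\<Sum>i\<in>- {v, u}. christoffel g k v i p * w $ i) * w $ v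
      + (\<Sum>i\<in>- {v, u}. christoffel g k u i p * w $ i) * w $ u
      + (\<Sum>i\<in>- {v, u}. christoffel g k i v p * w $ i) * w $ v
      + (\<Sum>i\<in>- {v, u}. christoffel g k i u p * w $ i) * w $ u" for k
    using v1(9)[of k]
    by (simp add: sum_UNIV_split[OF vu] sum.distrib sum_distrib_left sum_distrib_right mult_ac)
  have R: "(\<Sum>i\<in>- {v, u}. christoffel g k a i p * w $ i) = 0"
    "(\<Sum>i\<in>- {v, u}. christoffel g k i a p * w $ i) = 0" if "k \<in> - {v, u}" "a \<in> {v, u}" for k a
    using that by (auto intro!: sum.neutral simp: christoffel_g mixed_def dlower_def)
  have "- (\<Sum>i\<in>UNIV. \<Sum>j\<in>UNIV. christoffel g k i j p * w $ i * w $ j) = accel p w $ k" for k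
  proof -
    consider "k = v" | "k = u" | "k \<in> - {v, u}" by auto
    then show ?thesis
    proof cases
      case 1
      show ?thesis
        unfolding 1 eq v1 christoffel_table(1-7) by (simp add: accel_def power2_eq_square field_simps)
    next
      case 2
      show ?thesis
        unfolding 2 eq v1 christoffel_table(1-7) using uv by (simp add: accel_def field_simps)
    next
      case 3
      then show ?thesis
        unfolding eq by (auto simp: R christoffel_table accel_def field_simps)
    qed
  qed
  then show ?thesis by (simp add: vec_eq_iff)
qed

text \<open>For a geodesic \<open>2 v' + H u'\<close> is a constant \<open>c\<close>, the momentum of the Killing field \<open>\<partial>\<^sub>v\<close>.
  Given \<open>c\<close>, the coordinates other than \<open>v\<close> solve the following autonomous equation, which is that
  of a charged particle in a magnetic field on flat space.\<close>

definition magnetic :: "real \<Rightarrow> real ^ 'd \<Rightarrow> real ^ 'd \<Rightarrow> real ^ 'd"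
  where "magnetic c p w = (\<chi> k. if k = v then 0 else if k = u then - c * slope p w
    else c / 2 * dH k p * w $ u)"

text \<open>The field is a finite sum of constant vectors with coefficients
  \<open>dH i q * w $ j\<close>; on a product of balls both factors are bounded and
  Lipschitz.\<close>

lemma magnetic_lipschitz: "\<exists>L. L-lipschitz_on (cball 0 R \<times> cball 0 R) (\<lambda>(q, w). magnetic c q w)"
proof -
  have prod: "\<exists>L. L-lipschitz_on (cball 0 R \<times> cball 0 R) (\<lambda>z. (dH i (fst z) * snd z $ j) *\<^sub>R x)"
    for i j :: 'd and x :: "real ^ 'd"
  proof -
    obtain L where L: "L-lipschitz_on (cball 0 R) (dH i)"
      using smooth_lipschitz_on_cball[OF smooth_pderiv_at[OF smooth_H]] by blast
    have "bounded (dH i ` cball 0 R)"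
      by (intro compact_imp_bounded compact_continuous_image smooth_continuous smooth_pderiv_at smooth_H) simp
    then obtain B where "B > 0" and B: "\<And>q. q \<in> cball 0 R \<Longrightarrow> \<bar>dH i q\<bar> \<le> B"
      by (auto simp: bounded_pos)
    have "1-lipschitz_on (cball 0 R \<times> cball 0 R) (fst :: (real ^ 'd) \<times> (real ^ 'd) \<Rightarrow> real ^ 'd)"
      by (rule lipschitz_onI) (simp_all add: dist_fst_le)
    then have "(L * 1)-lipschitz_on (cball 0 R \<times> cball 0 R) (\<lambda>z::(real ^ 'd) \<times> (real ^ 'd). dH i (fst z))"
      by (rule lipschitz_on_compose2) (auto intro: lipschitz_on_subset[OF L] simp: lipschitz_on_nonneg[OF L])
    moreover have "1-lipschitz_on (cball 0 R \<times> cball 0 R) (\<lambda>z::(real ^ 'd) \<times> (real ^ 'd). snd z $ j)"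
      by (rule lipschitz_onI) (auto intro: order_trans[OF dist_vec_nth_le] dist_snd_le)
    \<comment> \<open>\<open>max 0 R\<close> bounds the components of \<open>w\<close> and stays
      nonnegative when the ball is empty.\<close>
    ultimately have "(B * 1 + max 0 R * (L * 1))-lipschitz_on (cball 0 R \<times> cball 0 R)
        (\<lambda>z::(real ^ 'd) \<times> (real ^ 'd). dH i (fst z) * snd z $ j)"
      using \<open>B > 0\<close> B
      by (intro lipschitz_on_mult) (auto intro: order_trans[OF component_le_norm_cart] simp: max_def)
    moreover obtain K where "K-lipschitz_on ((\<lambda>z. dH i (fst z) * snd z $ j) ` (cball 0 R \<times> cball 0 R)) (\<lambda>r. r *\<^sub>R x)"
      by (rule bounded_linear.lipschitz_boundE[OF bounded_linear_scaleR_left])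
    ultimately show ?thesis
      using lipschitz_on_compose2[where g = "\<lambda>r. r *\<^sub>R x"] by (intro exI)
  qed
  have "\<exists>L. L-lipschitz_on (cball 0 R \<times> cball 0 R) (\<lambda>z. (\<Sum>i\<in>- {v, u}. (dH i (fst z) * snd z $ i) *\<^sub>R (- c *\<^sub>R coord u)))"
    "\<exists>L. L-lipschitz_on (cball 0 R \<times> cball 0 R) (\<lambda>z. (\<Sum>i\<in>- {v, u}. (dH i (fst z) * snd z $ u) *\<^sub>R ((c / 2) *\<^sub>R coord i)))"
    by (rule lipschitz_on_sum, rule prod)+
  then have "\<exists>L. L-lipschitz_on (cball 0 R \<times> cball 0 R)
      (\<lambda>z. (\<Sum>i\<in>- {v, u}. (dH i (fst z) * snd z $ i) *\<^sub>R (- c *\<^sub>R coord u))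
         + (\<Sum>i\<in>- {v, u}. (dH i (fst z) * snd z $ u) *\<^sub>R ((c / 2) *\<^sub>R coord i)))"
    by (elim exE) (rule exI, rule lipschitz_on_add)
  moreover have "magnetic c q w = (\<Sum>i\<in>- {v, u}. (dH i q * w $ i) *\<^sub>R (- c *\<^sub>R coord u))
      + (\<Sum>i\<in>- {v, u}. (dH i q * w $ u) *\<^sub>R ((c / 2) *\<^sub>R coord i))" for q w
  proof -
    have "(\<Sum>i\<in>- {v, u}. (dH i q * w $ u) *\<^sub>R ((c / 2) *\<^sub>R coord i)) $ k
        = (if k \<in> - {v, u} then c / 2 * dH k q * w $ u else 0)" for k
    proof -
      have "(\<Sum>i\<in>- {v, u}. (dH i q * w $ u) *\<^sub>R ((c / 2) *\<^sub>R coord i)) $ k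
          = (\<Sum>i\<in>- {v, u}. (dH i q * w $ u) * (c / 2 * coord i $ k))"
        by (simp only: sum_component vector_scaleR_component real_scaleR_def)
      also have "\<dots> = (\<Sum>i\<in>- {v, u}. if i = k then c / 2 * dH k q * w $ u else 0)"
        by (rule sum.cong) (auto simp: axis_def)
      finally show ?thesis by simp
    qed
    moreover have "(\<Sum>i\<in>- {v, u}. (dH i q * w $ i) *\<^sub>R (- c *\<^sub>R coord u)) = (- c * slope q w) *\<^sub>R coord u"
      unfolding scaleR_sum_left[symmetric] slope_def[symmetric] by simp
    ultimately show ?thesis
      using uv by (auto simp: vec_eq_iff magnetic_def axis_def)
  qed
  ultimately show ?thesis
    by (auto simp: case_prod_unfold)
qed

lemma magnetic_global_solution:
  obtains y where "y 0 = (q0, w0)"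
    and "\<And>t. (y has_vector_derivative (case y t of (q, w) \<Rightarrow> (w, magnetic c q w))) (at t)"
proof -
  \<comment> \<open>The weight one half on the \<open>u\<close> component balances the coefficients
    \<open>- c\<close> and \<open>c / 2\<close> in \<open>magnetic\<close>, which makes the force
    skew. The \<open>v\<close> component of the force is zero, so its weight only serves
    definiteness.\<close>
  define N :: "real ^ 'd \<Rightarrow> real ^ 'd \<Rightarrow> real"
    where "N a b = a $ v * b $ v + a $ u * b $ u / 2 + (\<Sum>i\<in>- {v, u}. a $ i * b $ i)" for a b
  have "bilinear N"
    unfolding bilinear_def
    by (auto intro!: linearI simp: N_def algebra_simps sum.distrib sum_distrib_left add_divide_distrib)
  then have N: "bounded_bilinear N"
    by (simp add: bilinear_conv_bounded_bilinear)
  show thesis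
  proof (rule skew_second_order_global_solution[where A = "magnetic c" and N = N and m = "1/2"])
    show "magnetic c q (s *\<^sub>R w) = s *\<^sub>R magnetic c q w" for q w s
      by (simp add: magnetic_def slope_def vec_eq_iff sum_distrib_left mult_ac)
    show "1 / 2 * (norm w)\<^sup>2 \<le> N w w" for w
    proof -
      have "(\<Sum>i\<in>- {v, u}. w $ i * w $ i) \<ge> 0" "w $ v * w $ v \<ge> 0"
        by (auto intro: sum_nonneg)
      then show ?thesis
        by (simp add: N_def power2_norm_eq_inner inner_vec_def sum_UNIV_split[OF vu] flip: power2_eq_square)
    qed
    show "N w (magnetic c q w) = 0" for q w
    proof -
      have "(\<Sum>i\<in>- {v, u}. w $ i * magnetic c q w $ i) = c / 2 * w $ u * slope q w"
        by (simp add: magnetic_def slope_def sum_distrib_left mult_ac cong: sum.cong_simp)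
      then show ?thesis
        using uv by (simp add: N_def) (simp add: magnetic_def)
    qed
  qed (use N that magnetic_lipschitz in \<open>auto simp: N_def mult.commute\<close>)
qed


section \<open>From geodesics to magnetic trajectories and back\<close>

lemma dH_translate: "dH i (p + t *\<^sub>R coord v) = dH i p"
  by (rule pderiv_at_translation_invariant[OF H_translate H_diff])

lemma H_has_vector_derivative:
  assumes "(\<gamma> has_vector_derivative w) (at t)"
  shows "((\<lambda>t. H (\<gamma> t)) has_real_derivative dH u (\<gamma> t) * w $ u + slope (\<gamma> t) w) (at t)"
proof -
  have "((\<lambda>t. H (\<gamma> t)) has_derivative (\<lambda>h. frechet_derivative H (at (\<gamma> t)) (h *\<^sub>R w))) (at t)"
    using assms H_diff[unfolded frechet_derivative_works]
    unfolding has_vector_derivative_def by (rule has_derivative_compose)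
  moreover have "frechet_derivative H (at (\<gamma> t)) (h *\<^sub>R w) = (dH u (\<gamma> t) * w $ u + slope (\<gamma> t) w) * h" for h
    by (simp add: frechet_derivative_eq_pderiv_sum[OF H_diff] sum_UNIV_split[OF vu] slope_def
        sum_distrib_left algebra_simps)
  ultimately show ?thesis
    by (simp add: has_field_derivative_def)
qed

lemma momentum_derivative:
  assumes "(\<gamma> has_vector_derivative \<gamma>' t) (at t)"
    and "(\<gamma>' has_vector_derivative accel (\<gamma> t) (\<gamma>' t)) (at t)"
  shows "((\<lambda>t. 2 * \<gamma>' t $ v + H (\<gamma> t) * \<gamma>' t $ u) has_vector_derivative 0) (at t)"
proof -
  have nth: "((\<lambda>t. \<gamma>' t $ i) has_real_derivative accel (\<gamma> t) (\<gamma>' t) $ i) (at t)" for i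
    using has_vector_derivative_nth[OF assms(2)] by (simp add: has_real_derivative_iff_has_vector_derivative)
  have "((\<lambda>t. 2 * \<gamma>' t $ v + H (\<gamma> t) * \<gamma>' t $ u) has_real_derivative 0) (at t)"
    using uv
    by (auto intro!: derivative_eq_intros nth H_has_vector_derivative[OF assms(1)])
       (simp add: accel_def power2_eq_square field_simps)
  then show ?thesis
    by (simp add: has_real_derivative_iff_has_vector_derivative)
qed

text \<open>The projection along the Killing direction. It leaves \<open>H\<close> and its
  derivatives unchanged, so the reduced equation can be stated on the same space.\<close>

definition drop_v :: "real ^ 'd \<Rightarrow> real ^ 'd"
  where "drop_v a = (\<chi> k. if k = v then 0 else a $ k)"

lemma bounded_linear_drop_v: "bounded_linear drop_v"
  unfolding linear_conv_bounded_linear[symmetric]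
  by (rule linearI) (auto simp: drop_v_def vec_eq_iff)

lemma drop_v_eq: "drop_v a = a + (- a $ v) *\<^sub>R coord v"
  by (auto simp: drop_v_def vec_eq_iff axis_def)

lemma H_drop_v [simp]: "H (drop_v p) = H p" and dH_drop_v [simp]: "dH i (drop_v p) = dH i p"
  unfolding drop_v_eq by (simp_all only: H_translate dH_translate)

lemma drop_v_nth [simp]: "drop_v a $ v = 0" "k \<noteq> v \<Longrightarrow> drop_v a $ k = a $ k"
  by (simp_all add: drop_v_def)

lemma slope_drop_v [simp]: "slope (drop_v p) w = slope p w" "slope p (drop_v w) = slope p w"
  by (auto simp: slope_def intro!: sum.cong)

text \<open>With the momentum of \<open>(p, w)\<close> inserted for \<open>c\<close>, the geodesic
  acceleration projects to the magnetic one. As the momentum is constant along a geodesic, its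
  projection solves the autonomous equation.\<close>

lemma magnetic_drop_v: "magnetic (2 * w $ v + H p * w $ u) (drop_v p) (drop_v w) = drop_v (accel p w)"
  using uv by (auto simp: magnetic_def drop_v_def[of "accel p w"] accel_def vec_eq_iff algebra_simps)

lemma geodesic_on_iff: "geodesic_on g I \<gamma> \<longleftrightarrow> (\<exists>\<gamma>'. \<forall>t\<in>I.
    (\<gamma> has_vector_derivative \<gamma>' t) (at t) \<and> (\<gamma>' has_vector_derivative accel (\<gamma> t) (\<gamma>' t)) (at t))"
  by (simp add: geodesic_on_def geodesic_accel)

text \<open>The projected geodesic agrees on \<open>I\<close> with a global magnetic trajectory
  having the same data at a time \<open>a\<close>. The missing \<open>v\<close> coordinate is
  recovered by integrating the momentum relation over the whole line, and the resulting curve is a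
  geodesic extending the given one.\<close>

lemma geodesically_complete_g: "geodesically_complete g"
  unfolding geodesically_complete_def
proof (intro allI impI, elim conjE)
  fix I :: "real set" and \<gamma>
  assume I: "open I" "is_interval I" "I \<noteq> {}" and "geodesic_on g I \<gamma>"
  then obtain \<gamma>' where \<gamma>: "\<And>t. t \<in> I \<Longrightarrow> (\<gamma> has_vector_derivative \<gamma>' t) (at t)"
    and \<gamma>': "\<And>t. t \<in> I \<Longrightarrow> (\<gamma>' has_vector_derivative accel (\<gamma> t) (\<gamma>' t)) (at t)"
    by (auto simp: geodesic_on_iff)
  obtain a where a: "a \<in> I" using I by blast
  have "convex I" using I(2) by (rule is_interval_convex)
  obtain c where c: "2 * \<gamma>' t $ v + H (\<gamma> t) * \<gamma>' t $ u = c" if "t \<in> I" for t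
    by (rule has_vector_derivative_zero_constant[OF \<open>convex I\<close>
          has_vector_derivative_at_within[OF momentum_derivative[OF \<gamma> \<gamma>']]]) blast+
  obtain y where y0: "y 0 = (drop_v (\<gamma> a), drop_v (\<gamma>' a))"
    and y: "\<And>t. (y has_vector_derivative (case y t of (q, w) \<Rightarrow> (w, magnetic c q w))) (at t)"
    using magnetic_global_solution by blast
  \<comment> \<open>The global solution has its initial data at time 0, the geodesic at time
    \<open>a\<close>.\<close>
  define Y where "Y t = y (t - a)" for t
  have Y: "(Y has_vector_derivative (case Y t of (q, w) \<Rightarrow> (w, magnetic c q w))) (at t)" for t
  proof -
    have "((\<lambda>t. y (t - a)) has_vector_derivative 1 *\<^sub>R (case y (t - a) of (q, w) \<Rightarrow> (w, magnetic c q w))) (at t)"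
      by (rule vector_diff_chain_at[of "\<lambda>t. t - a" 1 t y, unfolded o_def, OF _ y])
         (auto intro!: derivative_eq_intros)
    then show ?thesis by (simp add: Y_def[abs_def])
  qed
  have Y_eq: "Y t = (drop_v (\<gamma> t), drop_v (\<gamma>' t))" if "t \<in> I" for t
  proof (rule ode_unique[OF second_order_field_lipschitz[OF magnetic_lipschitz[of _ c]] I(2) a that Y])
    show "Y a = (drop_v (\<gamma> a), drop_v (\<gamma>' a))" by (simp add: Y_def y0)
    show "((\<lambda>t. (drop_v (\<gamma> t), drop_v (\<gamma>' t))) has_vector_derivative
        (case (drop_v (\<gamma> s), drop_v (\<gamma>' s)) of (q, w) \<Rightarrow> (w, magnetic c q w))) (at s)" if "s \<in> I" for s
      using magnetic_drop_v[of "\<gamma>' s" "\<gamma> s"] c[OF that]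
        bounded_linear.has_vector_derivative[OF bounded_linear_drop_v \<gamma>[OF that]]
        bounded_linear.has_vector_derivative[OF bounded_linear_drop_v \<gamma>'[OF that]]
      by (auto intro!: has_vector_derivative_Pair)
  qed
  define Q W where "Q t = fst (Y t)" and "W t = snd (Y t)" for t
  have Q: "(Q has_vector_derivative W t) (at t)" for t
    using bounded_linear.has_vector_derivative[OF bounded_linear_fst Y, of t]
    by (simp add: Q_def[abs_def] W_def case_prod_unfold)
  have W: "(W has_vector_derivative magnetic c (Q t) (W t)) (at t)" for t
    using bounded_linear.has_vector_derivative[OF bounded_linear_snd Y, of t]
    by (simp add: Q_def W_def[abs_def] case_prod_unfold)
  have W_nth: "((\<lambda>t. W t $ i) has_real_derivative magnetic c (Q t) (W t) $ i) (at t)" for i t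
    using has_vector_derivative_nth[OF W] by (simp add: has_real_derivative_iff_has_vector_derivative)
  \<comment> \<open>The velocity in the direction \<open>v\<close>, solved from the momentum
    relation; \<open>\<rho>'\<close> is its derivative by the chain rule and the magnetic
    equation.\<close>
  define \<rho> where "\<rho> t = (c - H (Q t) * W t $ u) / 2" for t
  define \<rho>' where "\<rho>' t = - ((dH u (Q t) * W t $ u + slope (Q t) (W t)) * W t $ u
      - H (Q t) * (c * slope (Q t) (W t))) / 2" for t
  have \<rho>: "(\<rho> has_real_derivative \<rho>' t) (at t)" for t
    unfolding \<rho>_def[abs_def] \<rho>'_def using uv
    by (auto intro!: derivative_eq_intros W_nth H_has_vector_derivative[OF Q] simp: magnetic_def field_simps)
  then have "continuous_on UNIV \<rho>"
    by (auto intro!: continuous_at_imp_continuous_on DERIV_isCont)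
  \<comment> \<open>The constant is chosen so that \<open>V a = \<gamma> a $ v\<close>.\<close>
  define V where "V t = \<gamma> a $ v + primitive \<rho> t - primitive \<rho> a" for t
  have V: "(V has_vector_derivative \<rho> t) (at t)" for t
    unfolding V_def[abs_def]
    by (auto intro!: derivative_eq_intros primitive_has_vector_derivative \<open>continuous_on UNIV \<rho>\<close>)
  \<comment> \<open>Applying \<open>drop_v\<close> makes \<open>V\<close> the \<open>v\<close>
    coordinate of \<open>\<eta>\<close> at all times, without following the \<open>v\<close>
    component of \<open>Q\<close> outside \<open>I\<close>.\<close>
  define \<eta> where "\<eta> t = drop_v (Q t) + V t *\<^sub>R coord v" for t
  define \<eta>' where "\<eta>' t = drop_v (W t) + \<rho> t *\<^sub>R coord v" for t
  note bounded_linear.has_vector_derivative[OF bounded_linear_drop_v, derivative_intros]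
    bounded_linear.has_vector_derivative[OF bounded_linear_scaleR_left, derivative_intros]
  show "\<exists>\<eta>. geodesic_on g UNIV \<eta> \<and> (\<forall>t\<in>I. \<eta> t = \<gamma> t)"
  proof (intro exI conjI ballI)
    have "(\<eta> has_vector_derivative \<eta>' t) (at t)" for t
      unfolding \<eta>_def[abs_def] \<eta>'_def by (intro derivative_intros Q V)
    moreover have "(\<eta>' has_vector_derivative accel (\<eta> t) (\<eta>' t)) (at t)" for t
    proof -
      have "(\<eta>' has_vector_derivative drop_v (magnetic c (Q t) (W t)) + \<rho>' t *\<^sub>R coord v) (at t)"
        unfolding \<eta>'_def[abs_def]
        by (intro derivative_intros W \<rho>[unfolded has_real_derivative_iff_has_vector_derivative])
      moreover have "accel (\<eta> t) (\<eta>' t) = drop_v (magnetic c (Q t) (W t)) + \<rho>' t *\<^sub>R coord v"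
      proof -
        have 1: "H (\<eta> t) = H (Q t)" "dH i (\<eta> t) = dH i (Q t)" for i
          by (simp_all add: \<eta>_def H_translate dH_translate)
        have 2: "\<eta>' t $ v = \<rho> t" "k \<noteq> v \<Longrightarrow> \<eta>' t $ k = W t $ k" for k
          by (auto simp: \<eta>'_def axis_def)
        then have 3: "slope (\<eta> t) (\<eta>' t) = slope (Q t) (W t)"
          by (auto simp: slope_def 1 intro!: sum.cong)
        have "accel (\<eta> t) (\<eta>' t) $ v = \<rho>' t"
          using uv by (simp add: accel_def 1 2 3 \<rho>_def \<rho>'_def power2_eq_square field_simps)
        moreover have "accel (\<eta> t) (\<eta>' t) $ k = magnetic c (Q t) (W t) $ k" if "k \<noteq> v" for k
        proof -
          have "2 * \<rho> t + H (Q t) * W t $ u = c" by (simp add: \<rho>_def field_simps)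
          then show ?thesis
            using that uv by (auto simp: accel_def magnetic_def 1 2 3)
        qed
        ultimately show ?thesis
          by (auto simp: vec_eq_iff axis_def drop_v_def)
      qed
      ultimately show ?thesis by simp
    qed
    ultimately show "geodesic_on g UNIV \<eta>"
      by (auto simp: geodesic_on_iff)
    fix t
    assume t: "t \<in> I"
    have "((\<lambda>t. V t - \<gamma> t $ v) has_vector_derivative 0) (at s within I)" if "s \<in> I" for s
    proof -
      have "\<rho> s = \<gamma>' s $ v"
        using Y_eq[OF that] c[OF that] uv by (simp add: \<rho>_def Q_def W_def)
      then show ?thesis
        using has_vector_derivative_diff[OF V has_vector_derivative_nth[OF \<gamma>[OF that], of v]]
        by (simp add: has_vector_derivative_at_within)
    qed
    then obtain k where "V s - \<gamma> s $ v = k" if "s \<in> I" for s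
      by (rule has_vector_derivative_zero_constant[OF \<open>convex I\<close>]) blast+
    then have "V t - \<gamma> t $ v = V a - \<gamma> a $ v"
      using a t by simp
    then have "V t = \<gamma> t $ v" by (simp add: V_def)
    then show "\<eta> t = \<gamma> t"
      using Y_eq[OF t] by (auto simp: \<eta>_def Q_def vec_eq_iff axis_def drop_v_def)
  qed
qed

end

section \<open>The almost complex structure\<close>

text \<open>The involution \<open>s\<close> exchanges the two coordinates of each transverse complex
  plane, and the sign \<open>e\<close> orients the plane: \<open>J\<close> maps
  \<open>coord i\<close> to \<open>- e i *\<^sub>R coord (s i)\<close>.\<close>

locale pp_almost_complex = pp_metric v u H
  for v u :: "'d::finite" and H +
  fixes s :: "'d \<Rightarrow> 'd" and e :: "'d \<Rightarrow> real"
  assumes s_in: "i \<in> - {v, u} \<Longrightarrow> s i \<in> - {v, u}"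
    and s_s: "i \<in> - {v, u} \<Longrightarrow> s (s i) = i"
    and e_s: "i \<in> - {v, u} \<Longrightarrow> e (s i) = - e i"
    and e_e: "i \<in> - {v, u} \<Longrightarrow> e i * e i = 1"
begin

text \<open>The \<open>(v, u)\<close>-block has trace zero and determinant one, so it squares to
  minus the identity by Cayley-Hamilton; on each transverse plane \<open>J\<close> is a rotation by
  a right angle.\<close>

definition J :: "'d endo_field"
  where "J p a = (\<chi> m. if m = v then H p * a $ v + (1 + (H p)\<^sup>2) / 2 * a $ u
    else if m = u then - 2 * a $ v - H p * a $ u else e m * a $ s m)"

lemma J_nth: "J p a $ v = H p * a $ v + (1 + (H p)\<^sup>2) / 2 * a $ u"
  "J p a $ u = - 2 * a $ v - H p * a $ u"
  "i \<in> - {v, u} \<Longrightarrow> J p a $ i = e i * a $ s i"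
  using vu uv by (auto simp: J_def)

lemma vec_eq_split: "a = b \<longleftrightarrow> a $ v = b $ v \<and> a $ u = b $ u \<and> (\<forall>i\<in>- {v, u}. a $ i = b $ i)"
  for a b :: "real ^ 'd"
  by (auto simp: vec_eq_iff)

lemma linear_J: "linear (J p)"
  by (rule linearI) (auto simp: vec_eq_split J_nth algebra_simps add_divide_distrib)

lemma J_J: "J p (J p a) = - a"
  using s_in by (auto simp: vec_eq_split J_nth s_s e_s e_e power2_eq_square field_simps)

lemma J_coord_v: "J p (coord v) = H p *\<^sub>R coord v - 2 *\<^sub>R coord u"
  using s_in vu uv by (auto simp: vec_eq_split J_nth axis_def)

lemma J_coord_u: "J p (coord u) = ((1 + (H p)\<^sup>2) / 2) *\<^sub>R coord v - H p *\<^sub>R coord u"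
  using s_in vu uv by (auto simp: vec_eq_split J_nth axis_def)

lemma s_neq: "i \<in> - {v, u} \<Longrightarrow> s i \<noteq> i"
  using e_s[of i] e_e[of i] by auto

lemma J_coord:
  assumes "i \<in> - {v, u}"
  shows "J p (coord i) = - e i *\<^sub>R coord (s i)"
  using assms s_in[of i] s_neq[of i] s_in s_s vu uv by (auto simp: vec_eq_split J_nth axis_def e_s)

lemma almost_complex_J: "almost_complex J"
  unfolding almost_complex_def
proof (intro conjI allI linear_J J_J)
  show "smooth (\<lambda>p. J p (coord i))" for i
  proof (cases "i \<in> - {v, u}")
    case True
    then show ?thesis by (simp add: J_coord)
  next
    case False
    have "smooth (\<lambda>p. H p *\<^sub>R coord v + (- 2) *\<^sub>R coord u)"
      and "smooth (\<lambda>p. ((1 + (H p)\<^sup>2) / 2) *\<^sub>R coord v + (0 + (-1) * H p) *\<^sub>R coord u)"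
      by (intro smooth_add smooth_scaleR smooth_H smooth_affine_H smooth_const)+
    then show ?thesis using False by (auto simp: J_coord_v J_coord_u)
  qed
qed

section \<open>The fundamental form and compatibility\<close>

lemma fundamental_form_J: "fundamental_form g J p a b
    = a $ v * b $ u - a $ u * b $ v + (\<Sum>i\<in>- {v, u}. e i * a $ i * b $ s i)"
  by (simp add: fundamental_form_def g_def J_nth power2_eq_square mult_ac cong: sum.cong_simp)
     (simp add: field_simps)

lemma fundamental_form_antisym: "fundamental_form g J p a b = - fundamental_form g J p b a"
proof -
  \<comment> \<open>Reindexing by \<open>s\<close> exchanges the roles of \<open>a\<close> and
    \<open>b\<close>, and \<open>e\<close> changes sign.\<close>
  have "(\<Sum>i\<in>- {v, u}. e i * a $ i * b $ s i) = (\<Sum>i\<in>- {v, u}. - (e i * b $ i * a $ s i))"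
    by (rule sum.reindex_bij_witness[where i = s and j = s]) (use s_in in \<open>auto simp: s_s e_s\<close>)
  then show ?thesis
    by (simp add: fundamental_form_J sum_negf)
qed

text \<open>Formal from skewness of the fundamental form and \<open>J_J\<close>: moving
  \<open>J\<close> from one argument of \<open>g\<close> to the other costs a sign, and applying it
  twice costs another.\<close>

lemma compatible_J: "compatible g J"
  unfolding compatible_def
proof (intro allI)
  fix p a b
  have "g p (J p a) (J p b) = - fundamental_form g J p b (J p a)"
    using fundamental_form_antisym[of p "J p a" b] by (simp add: fundamental_form_def)
  also have "\<dots> = g p a b"
    using riemannian_metric_g by (simp add: fundamental_form_def J_J riemannian_metric_def bilinear_rneg)
  finally show "g p (J p a) (J p b) = g p a b" .
qed

lemma closed_fundamental_form: "closed_form (fundamental_form g J)"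
  by (simp add: closed_form_def ext_deriv_def fundamental_form_J frechet_derivative_const)

lemma almost_kaehler_J: "almost_kaehler g J"
  by (simp add: almost_kaehler_def riemannian_metric_g almost_complex_J compatible_J closed_fundamental_form)

text \<open>The derivative of \<open>J\<close> with respect to the value of \<open>H\<close>,
  through which alone \<open>J\<close> depends on the point.\<close>

definition dJ :: "'d endo_field"
  where "dJ p a = (a $ v + H p * a $ u) *\<^sub>R coord v - a $ u *\<^sub>R coord u"

lemma J_has_derivative:
  assumes "(a has_derivative a') (at p)"
  shows "((\<lambda>q. J q (a q)) has_derivative
    (\<lambda>h. J p (a' h) + frechet_derivative H (at p) h *\<^sub>R dJ p (a p))) (at p)"
proof -
  \<comment> \<open>The part of \<open>J\<close> that is constant in \<open>p\<close>; only the two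
    scalar coefficients containing \<open>H\<close> then need the product rule.\<close>
  define J0 :: "real ^ 'd \<Rightarrow> real ^ 'd"
    where "J0 w = (\<chi> m. if m = v then w $ u / 2 else if m = u then - 2 * w $ v else e m * w $ s m)" for w
  have J: "J q w = J0 w + (H q * w $ v + (H q)\<^sup>2 / 2 * w $ u) *\<^sub>R coord v - (H q * w $ u) *\<^sub>R coord u" for q w
    using vu uv by (auto simp: vec_eq_split J_nth J0_def axis_def algebra_simps add_divide_distrib)
  have "linear J0"
    by (rule linearI) (auto simp: vec_eq_iff J0_def algebra_simps)
  then have J0: "bounded_linear J0"
    by (simp add: linear_conv_bounded_linear)
  have H: "(H has_derivative frechet_derivative H (at p)) (at p)"
    using H_diff frechet_derivative_works by blast
  have a: "((\<lambda>q. a q $ i) has_derivative (\<lambda>h. a' h $ i)) (at p)" for i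
    by (rule bounded_linear.has_derivative[OF bounded_linear_vec_nth assms])
  have "((\<lambda>q. J q (a q)) has_derivative (\<lambda>h. J0 (a' h)
      + ((H p * a' h $ v + frechet_derivative H (at p) h * a p $ v)
         + ((H p)\<^sup>2 / 2 * a' h $ u + (H p * frechet_derivative H (at p) h) * a p $ u)) *\<^sub>R coord v
      - (H p * a' h $ u + frechet_derivative H (at p) h * a p $ u) *\<^sub>R coord u)) (at p)"
    unfolding J
    by (auto intro!: derivative_eq_intros bounded_linear.has_derivative[OF J0] H assms a)
  then show ?thesis
    by (rule has_derivative_eq_rhs) (simp add: J dJ_def fun_eq_iff algebra_simps power2_eq_square)
qed

text \<open>All terms with derivatives of \<open>a\<close> and \<open>b\<close> cancel in pairs
  because \<open>J\<close> squares to minus the identity. What remains comes from differentiating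
  \<open>J\<close> through \<open>H\<close>.\<close>

lemma nijenhuis_J:
  assumes "a differentiable at p" "b differentiable at p"
  shows "nijenhuis J a b p = frechet_derivative H (at p) (J p (a p)) *\<^sub>R dJ p (b p)
    - frechet_derivative H (at p) (J p (b p)) *\<^sub>R dJ p (a p)
    + frechet_derivative H (at p) (b p) *\<^sub>R J p (dJ p (a p))
    - frechet_derivative H (at p) (a p) *\<^sub>R J p (dJ p (b p))"
proof -
  interpret J: linear "J p" by (rule linear_J)
  have "frechet_derivative (\<lambda>q. J q (c q)) (at p)
      = (\<lambda>h. J p (frechet_derivative c (at p) h) + frechet_derivative H (at p) h *\<^sub>R dJ p (c p))"
    if "c differentiable at p" for c
    using frechet_derivative_at[OF J_has_derivative[OF that[unfolded frechet_derivative_works]]] by simp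
  then show ?thesis
    using assms by (simp add: nijenhuis_def lie_bracket_def J.add J.diff J.scale J_J)
qed

lemma frechet_derivative_H: "frechet_derivative H (at p) (coord i) = dH i p"
  by (simp add: pderiv_at_def)

lemma kaehler_J_iff: "kaehler g J \<longleftrightarrow> scalar_flat g"
proof
  assume "kaehler g J"
  then have N: "nijenhuis J a b p = 0" if "smooth a" "smooth b" for a b p
    using that by (simp add: kaehler_def integrable_acs_def)
  have "dH i p = 0" if i: "i \<in> - {v, u}" for i p
  proof -
    \<comment> \<open>Here \<open>dJ\<close> fixes \<open>coord v\<close> and kills
      \<open>coord i\<close>. The term along \<open>coord v\<close> is invisible in the
      \<open>u\<close> component, and the remaining one is \<open>dH i p\<close> times the
      \<open>u\<close> component \<open>- 2\<close> of \<open>J p (coord v)\<close>.\<close>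
    have "nijenhuis J (\<lambda>q. coord v) (\<lambda>q. coord i) p $ u = - 2 * dH i p"
    proof -
      have "dJ p (coord v) = coord v" "dJ p (coord i) = 0"
        and "(coord v :: real ^ 'd) $ u = 0" "(coord u :: real ^ 'd) $ u = 1"
        using i vu uv by (auto simp: dJ_def axis_def)
      then show ?thesis
        using vu by (simp add: nijenhuis_J J_coord_v frechet_derivative_H linear_0[OF linear_J])
    qed
    then show ?thesis by (simp add: N)
  qed
  then show "scalar_flat g"
    by (auto simp: scalar_flat_iff fun_eq_iff) (metis Compl_iff dH_v' insert_iff singletonD)
next
  assume flat: "scalar_flat g"
  have D: "frechet_derivative H (at p) h = h $ u * dH u p" for h p
  proof -
    have "(\<Sum>i\<in>UNIV. h $ i * dH i p) = (\<Sum>i\<in>UNIV. if i = u then h $ i * dH i p else 0)"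
      using flat by (intro sum.cong) (auto simp: scalar_flat_iff)
    then show ?thesis
      by (simp add: frechet_derivative_eq_pderiv_sum[OF H_diff])
  qed
  \<comment> \<open>When the differential of \<open>H\<close> is a multiple of \<open>du\<close>,
    only the \<open>(v, u)\<close>-components of \<open>a\<close> and \<open>b\<close> enter, and in
    real dimension two every Nijenhuis tensor vanishes.\<close>
  have "nijenhuis J a b p = 0" if "smooth a" "smooth b" for a b p
    using vu uv s_in unfolding nijenhuis_J[OF that[THEN smooth_differentiable]] D
    by (auto simp: vec_eq_split J_nth dJ_def axis_def power2_eq_square field_simps)
  then show "kaehler g J"
    by (simp add: kaehler_def almost_kaehler_J integrable_acs_def)
qed

end

section \<open>Identification with the pp-wave dual\<close>

locale pp_coordinates =
  fixes n :: nat and c :: "nat \<Rightarrow> 'd::finite" and H :: "real ^ 'd \<Rightarrow> real"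
  assumes n: "n \<ge> 2"
    and c: "bij_betw c {1..2*n} (UNIV :: 'd set)"
    and smooth: "smooth H"
    and H_indep: "\<And>p q. (\<forall>i\<in>{2..2*n}. p $ c i = q $ c i) \<Longrightarrow> H p = H q"
begin

declare One_nat_def [simp del]

definition index :: "'d \<Rightarrow> nat"
  where "index = inv_into {1..2*n} c"

lemma c_eq_iff: "i \<in> {1..2*n} \<Longrightarrow> j \<in> {1..2*n} \<Longrightarrow> c i = c j \<longleftrightarrow> i = j"
  using inj_on_eq_iff[OF bij_betw_imp_inj_on[OF c]] by blast

lemma index_c: "i \<in> {1..2*n} \<Longrightarrow> index (c i) = i"
  unfolding index_def by (rule inv_into_f_f[OF bij_betw_imp_inj_on[OF c]])

lemma c12: "c 1 \<noteq> c 2"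
  using n by (simp add: c_eq_iff)

lemma transverse_range: "- {c 1, c 2} = c ` {3..2*n}"
proof -
  have "UNIV = c ` {1..2*n}" using c by (simp add: bij_betw_def)
  also have "{1..2*n} = insert 1 (insert 2 {3..2*n})" using n by auto
  finally have "UNIV = insert (c 1) (insert (c 2) (c ` {3..2*n}))" by simp
  moreover have "c 1 \<notin> c ` {3..2*n}" "c 2 \<notin> c ` {3..2*n}"
    using n by (auto simp: c_eq_iff)
  ultimately show ?thesis by blast
qed

lemma transverse_cases:
  assumes "i \<in> - {c 1, c 2}"
  obtains k where "k \<in> {2..n}" "i = c (2 * k - 1)" | k where "k \<in> {2..n}" "i = c (2 * k)"
proof -
  obtain j where j: "j \<in> {3..2*n}" "i = c j"
    using assms unfolding transverse_range by auto
  show thesis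
  proof (cases "even j")
    case True
    then show thesis using j that(2)[of "j div 2"] by auto
  next
    case False
    then show thesis using j that(1)[of "(j + 1) div 2"] by (auto elim!: oddE)
  qed
qed

lemma sum_transverse: "(\<Sum>i\<in>- {c 1, c 2}. f i) = (\<Sum>i\<in>{3..2*n}. f (c i))"
  unfolding transverse_range by (subst sum.reindex) (auto simp: inj_on_def c_eq_iff)

definition partner :: "'d \<Rightarrow> 'd"
  where "partner i = (if odd (index i) then c (index i + 1) else c (index i - 1))"

text \<open>The sign belongs to the component that is produced: \<open>X_(2k-1)\<close> going to
  \<open>X_(2k)\<close> needs \<open>+ 1\<close> at the even index, and then the odd index must
  carry \<open>- 1\<close>.\<close>

definition orientation :: "'d \<Rightarrow> real"
  where "orientation i = (if odd (index i) then - 1 else 1)"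

lemma partner_c:
  assumes "k \<in> {2..n}"
  shows "partner (c (2 * k - 1)) = c (2 * k)" "partner (c (2 * k)) = c (2 * k - 1)"
    "orientation (c (2 * k - 1)) = - 1" "orientation (c (2 * k)) = 1"
proof -
  have "index (c (2 * k - 1)) = 2 * k - 1" "index (c (2 * k)) = 2 * k"
    by (rule index_c; use assms in auto)+
  then show "partner (c (2 * k - 1)) = c (2 * k)" "partner (c (2 * k)) = c (2 * k - 1)"
    "orientation (c (2 * k - 1)) = - 1" "orientation (c (2 * k)) = 1"
    using assms by (auto simp: partner_def orientation_def)
qed

lemma transverse_c: "k \<in> {2..n} \<Longrightarrow> c (2 * k - 1) \<in> - {c 1, c 2}" "k \<in> {2..n} \<Longrightarrow> c (2 * k) \<in> - {c 1, c 2}"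
  unfolding transverse_range by (rule imageI; auto)+

sublocale pp_almost_complex "c 1" "c 2" H partner orientation
proof
  show "c 1 \<noteq> c 2" by (rule c12)
  show "smooth H" by (rule smooth)
  show "H (p + t *\<^sub>R coord (c 1)) = H p" for p t
    \<comment> \<open>A translation along \<open>c 1\<close> leaves the coordinates numbered
      \<open>2\<close> to \<open>2*n\<close> unchanged.\<close>
    by (rule H_indep) (use n in \<open>auto simp: axis_def c_eq_iff\<close>)
  fix i
  assume "i \<in> - {c 1, c 2}"
  then show "partner i \<in> - {c 1, c 2}" "partner (partner i) = i"
    "orientation (partner i) = - orientation i" "orientation i * orientation i = 1"
    by (cases rule: transverse_cases; simp only: partner_c transverse_c; simp)+
qed

text \<open>The form dual to \<open>T\<close> is \<open>(1 - H) / 2 du - dv\<close>; adding twice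
  its square to the pp-wave metric and completing the square gives \<open>g\<close>.\<close>

lemma pp_dual_eq_g: "pp_dual n c H = g"
proof (intro ext)
  fix p a b
  have "T_field c H p $ c i = 0" if "i \<in> {3..2*n}" for i
    using that n by (simp add: T_field_def axis_def c_eq_iff)
  then have T: "pp_wave n c H p (T_field c H p) a = (1 - H p) / 2 * a $ c 2 - a $ c 1" for a
    using c12 by (simp add: pp_wave_def) (simp add: T_field_def axis_def field_simps)
  show "pp_dual n c H p a b = g p a b"
    unfolding pp_dual_def T unfolding pp_wave_def g_def sum_transverse
    by (simp add: power2_eq_square field_simps)
qed

lemma T_Z: "T_field c H p - Z_field c H p = coord (c 1)"
  "coord (c 2) = ((H p + 1) / 2) *\<^sub>R coord (c 1) - T_field c H p"
  by (simp_all add: T_field_def Z_field_def flip: scaleR_diff_left add: diff_divide_distrib[symmetric])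

text \<open>The definite description needs uniqueness as well. Any admissible \<open>L\<close> sends
  \<open>Z\<close> to \<open>- T\<close>, and \<open>T\<close> and \<open>Z\<close> span the
  \<open>(v, u)\<close>-plane because their difference is \<open>coord (c 1)\<close>; on even
  transverse coordinates \<open>L\<close> is forced by \<open>L (L a) = - a\<close>. So
  \<open>L\<close> is determined on the standard basis.\<close>

lemma pp_J_eq_J: "pp_J n c H = J"
proof (rule ext)
  fix p
  let ?T = "T_field c H p" and ?Z = "Z_field c H p"
  define spec where "spec L \<longleftrightarrow> linear L \<and> (\<forall>a. L (L a) = - a) \<and> L ?T = ?Z \<and>
    (\<forall>k\<in>{2..n}. L (coord (c (2*k - 1))) = coord (c (2*k)))" for L
  have "J p ?T = ?Z"
    using linear_J[of p] by (simp add: T_field_def Z_field_def linear_diff linear_scale J_coord_v J_coord_u)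
      (simp add: vec_eq_iff axis_def power2_eq_square field_simps)
  moreover have "J p (coord (c (2*k - 1))) = coord (c (2*k))" if "k \<in> {2..n}" for k
    using J_coord[OF transverse_c(1)[OF that]] by (simp add: partner_c[OF that])
  ultimately have "spec (J p)"
    by (simp add: spec_def linear_J J_J)
  moreover have "L = M" if "spec L" "spec M" for L M
  proof -
    have v: "N (coord (c 1)) = ?Z + ?T" if "spec N" for N
    proof -
      have "N ?Z = - ?T" "linear N" "N ?T = ?Z" using that by (metis spec_def)+
      then show ?thesis
        unfolding T_Z(1)[of p, symmetric] by (simp add: linear_diff)
    qed
    have u: "N (coord (c 2)) = ((H p + 1) / 2) *\<^sub>R (?Z + ?T) - ?Z" if "spec N" for N
    proof -
      have "linear N" "N ?T = ?Z" using that by (auto simp: spec_def)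
      then show ?thesis
        unfolding T_Z(2)[of p] by (simp add: linear_diff linear_scale v[OF that])
    qed
    have even: "N (coord (c (2 * k))) = - coord (c (2 * k - 1))" if "spec N" "k \<in> {2..n}" for N k
      using that by (metis spec_def)
    have "L (coord i) = M (coord i)" for i
    proof (cases "i \<in> - {c 1, c 2}")
      case True
      then show ?thesis
      proof (cases rule: transverse_cases)
        case (1 k)
        then show ?thesis using that by (simp add: spec_def)
      next
        case (2 k)
        then show ?thesis using even[OF that(1) 2(1)] even[OF that(2) 2(1)] by simp
      qed
    next
      case False
      then show ?thesis using u[OF that(1)] u[OF that(2)] v[OF that(1)] v[OF that(2)] by auto
    qed
    moreover have "linear L" "linear M" using that by (auto simp: spec_def)
    ultimately show "L = M"
      by (intro linear_eq_stdbasis) (auto simp: Basis_vec_def)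
  qed
  ultimately have "(THE L. spec L) = J p"
    by (intro the_equality) auto
  then show "pp_J n c H p = J p"
    by (simp add: pp_J_def spec_def)
qed

end

theorem theorem1:
  fixes n :: nat and c :: "nat \<Rightarrow> 'd::finite" and H :: "real ^ 'd \<Rightarrow> real"
  assumes "n \<ge> 2"
    and "bij_betw c {1..2*n} (UNIV :: 'd set)"
    and "smooth H"
    and "\<And>p q. (\<forall>i\<in>{2..2*n}. p $ c i = q $ c i) \<Longrightarrow> H p = H q"
  shows "almost_kaehler (pp_dual n c H) (pp_J n c H)
    \<and> geodesically_complete (pp_dual n c H)
    \<and> (\<forall>p. scalar_curvature (pp_dual n c H) p \<le> 0)
    \<and> (kaehler (pp_dual n c H) (pp_J n c H) \<longleftrightarrow> scalar_flat (pp_dual n c H))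
    \<and> (flat_metric (pp_dual n c H) \<longleftrightarrow> scalar_flat (pp_dual n c H))"
proof -
  interpret pp_coordinates n c H
    by unfold_locales (use assms in auto)
  show ?thesis
    unfolding pp_dual_eq_g pp_J_eq_J
    using almost_kaehler_J geodesically_complete_g scalar_curvature_nonpos kaehler_J_iff
      scalar_flat_if_flat flat_if_scalar_flat by blast
qed

end
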